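(* Let $H$ be a cancellative monoid and let $r$ be an ideal system on $H$ such that $H$ is $r$-noetherian. \begin{enumerate} \item If the monoid $(\mathcal I_r^*(H),\cdot_r)$ has a prime element, and if $\mathcal I_r^*(H)$ either has accepted elasticity or is locally finitely generated, then $\mathcal I_r^*(H)$ is fully elastic. \item Suppose that $H$ has finite $r$-character and satisfies the $r$-Krull Intersection Theorem. If $H$ has an $r$-invertible prime $r$-ideal, and if either $\mathcal I_r(H)$ has accepted elasticity or every divisor-closed submonoid of $\mathcal I_r(H)$ generated by one element has accepted elasticity, then $(\mathcal I_r(H),\cdot_r)$ is fully elastic. \end{enumerate}
   Context: An ideal system on a cancellative commutative monoid $H$ (with quotient group $\mathsf q(H)$) is a map $X\mapsto X_r$ on subsets of $H$ such that for all $X,Y\subseteq H$ and $a\in H$: $X\subseteq X_r$; $X\subseteq Y_r$ implies $X_r\subseteq Y_r$; $aH\subseteq\{a\}_r$; $aX_r=(aX)_r$. An $r$-ideal is a subset $I$ with $I_r=I$; $\mathcal I_r(H)$ is the set of nonempty $r$-ideals with $r$-multiplication $I\cdot_r J=(IJ)_r$. $r$ extends to fractional ideals (subsets $X\subseteq\mathsf q(H)$ with $cX\subseteq H$ for some $c\in H$) by $X_r=c^{-1}(cX)_r$; an $r$-ideal $I$ is $r$-invertible if $(IJ)_r=H$ for some fractional $r$-ideal $J$. $\mathcal I_r^*(H)\subseteq\mathcal I_r(H)$ is the cancellative monoid of $r$-invertible $r$-ideals. $H$ is $r$-noetherian if it satisfies the ACC on $r$-ideals; it has finite $r$-character if every element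 of $H$ lies in only finitely many maximal $r$-ideals; it satisfies the $r$-Krull Intersection Theorem if $\bigcap_{n\ge0}(I^n)_r=\emptyset$ for all $I\in\mathcal I_r(H)\setminus\{H\}$. A prime $r$-ideal is an $r$-ideal $P\neq H$ with $ab\in P\Rightarrow a\in P$ or $b\in P$. Arithmetic notions (for a commutative unit-cancellative semigroup $M$ with identity): atoms, $\mathsf L(a)$ = set of $\ell$ with $a=\varepsilon u_1\cdots u_\ell$ ($\varepsilon$ a unit, $u_i$ atoms), $\mathcal L(M)=\{\mathsf L(a)\}$; $\rho(L)=\max L/\min L$, $\rho(\{0\})=1$, $\rho(M)=\sup_{L\in\mathcal L(M)}\rho(L)$; accepted elasticity: $\rho(L)=\rho(M)$ for some $L\in\mathcal L(M)$; fully elastic: every rational $q$ with $1<q<\rho(M)$ equals $\rho(L)$ for some $L\in\mathcal L(M)$. A prime element $p$ is a non-unit with $p\mid ab\Rightarrow p\mid a$ or $p\mid b$. For $a\in M$, the divisor-closed submonoid generated by $a$ is the set of all divisors in $M$ of powers of $a$; $M$ is locally finitely generated if for every $a$ this submonoid modulo units is finitely generated. *)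

theory Defs
  imports "HOL-Algebra.Algebra" "HOL-Library.Extended_Real"
begin

text \<open>A cancellative commutative monoid H is represented as a submonoid of a commutative
  group G with G = q(H), i.e. every element of G is of the form a b^{-1} with a, b in H.\<close>

definition quotient_group_of :: "('a, 'b) monoid_scheme \<Rightarrow> 'a set \<Rightarrow> bool" where
  "quotient_group_of G H \<longleftrightarrow> comm_group G \<and> H \<subseteq> carrier G \<and> \<one>\<^bsub>G\<^esub> \<in> H
     \<and> (\<forall>a\<in>H. \<forall>b\<in>H. a \<otimes>\<^bsub>G\<^esub> b \<in> H)
     \<and> carrier G = {a \<otimes>\<^bsub>G\<^esub> inv\<^bsub>G\<^esub> b | a b. a \<in> H \<and> b \<in> H}"

definition ideal_system :: "('a, 'b) monoid_scheme \<Rightarrow> 'a set \<Rightarrow> ('a set \<Rightarrow> 'a set) \<Rightarrow> bool" where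
  "ideal_system G H r \<longleftrightarrow> quotient_group_of G H
     \<and> (\<forall>S. S \<subseteq> H \<longrightarrow> r S \<subseteq> H)
     \<and> (\<forall>S. S \<subseteq> H \<longrightarrow> S \<subseteq> r S)
     \<and> (\<forall>S T. S \<subseteq> H \<longrightarrow> T \<subseteq> H \<longrightarrow> S \<subseteq> r T \<longrightarrow> r S \<subseteq> r T)
     \<and> (\<forall>a\<in>H. l_coset G a (H) \<subseteq> r {a})
     \<and> (\<forall>a\<in>H. \<forall>S. S \<subseteq> H \<longrightarrow> l_coset G a (r S) = r (l_coset G a S))"

definition r_ideal :: "'a set \<Rightarrow> ('a set \<Rightarrow> 'a set) \<Rightarrow> 'a set \<Rightarrow> bool" where
  "r_ideal H r I \<longleftrightarrow> I \<subseteq> H \<and> r I = I"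

definition r_ideals :: "'a set \<Rightarrow> ('a set \<Rightarrow> 'a set) \<Rightarrow> 'a set set" where
  "r_ideals H r = {I. r_ideal H r I \<and> I \<noteq> {}}"

definition fractional :: "('a, 'b) monoid_scheme \<Rightarrow> 'a set \<Rightarrow> 'a set \<Rightarrow> bool" where
  "fractional G H S \<longleftrightarrow> S \<subseteq> carrier G \<and> (\<exists>c\<in>H. l_coset G c (S) \<subseteq> H)"

definition frac_r :: "('a, 'b) monoid_scheme \<Rightarrow> 'a set \<Rightarrow> ('a set \<Rightarrow> 'a set) \<Rightarrow> 'a set \<Rightarrow> 'a set" where
  "frac_r G H r S = (let c = (SOME c. c \<in> H \<and> l_coset G c (S) \<subseteq> H)
                      in l_coset G (inv\<^bsub>G\<^esub> c) (r (l_coset G c S)))"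

definition frac_r_ideal :: "('a, 'b) monoid_scheme \<Rightarrow> 'a set \<Rightarrow> ('a set \<Rightarrow> 'a set) \<Rightarrow> 'a set \<Rightarrow> bool" where
  "frac_r_ideal G H r J \<longleftrightarrow> fractional G H J \<and> frac_r G H r J = J"

definition r_invertible :: "('a, 'b) monoid_scheme \<Rightarrow> 'a set \<Rightarrow> ('a set \<Rightarrow> 'a set) \<Rightarrow> 'a set \<Rightarrow> bool" where
  "r_invertible G H r I \<longleftrightarrow>
     (\<exists>J. frac_r_ideal G H r J \<and> frac_r G H r (set_mult G I J) = H)"

definition Ir_monoid :: "('a, 'b) monoid_scheme \<Rightarrow> 'a set \<Rightarrow> ('a set \<Rightarrow> 'a set) \<Rightarrow> 'a set monoid" where
  "Ir_monoid G H r = \<lparr>carrier = r_ideals H r, monoid.mult = (\<lambda>I J. r (set_mult G I J)), one = H\<rparr>"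

definition Ir_star_monoid :: "('a, 'b) monoid_scheme \<Rightarrow> 'a set \<Rightarrow> ('a set \<Rightarrow> 'a set) \<Rightarrow> 'a set monoid" where
  "Ir_star_monoid G H r =
     \<lparr>carrier = {I \<in> r_ideals H r. r_invertible G H r I}, monoid.mult = (\<lambda>I J. r (set_mult G I J)), one = H\<rparr>"

definition r_noetherian :: "'a set \<Rightarrow> ('a set \<Rightarrow> 'a set) \<Rightarrow> bool" where
  "r_noetherian H r \<longleftrightarrow>
     (\<forall>f :: nat \<Rightarrow> 'a set. (\<forall>n. r_ideal H r (f n) \<and> f n \<subseteq> f (Suc n))
        \<longrightarrow> (\<exists>m. \<forall>n\<ge>m. f n = f m))"

definition max_r_ideal :: "'a set \<Rightarrow> ('a set \<Rightarrow> 'a set) \<Rightarrow> 'a set \<Rightarrow> bool" where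
  "max_r_ideal H r M \<longleftrightarrow> r_ideal H r M \<and> M \<noteq> H
     \<and> (\<forall>J. r_ideal H r J \<and> M \<subseteq> J \<and> J \<noteq> H \<longrightarrow> J = M)"

definition finite_r_character :: "'a set \<Rightarrow> ('a set \<Rightarrow> 'a set) \<Rightarrow> bool" where
  "finite_r_character H r \<longleftrightarrow> (\<forall>a\<in>H. finite {M. max_r_ideal H r M \<and> a \<in> M})"

primrec set_pow :: "('a, 'b) monoid_scheme \<Rightarrow> 'a set \<Rightarrow> nat \<Rightarrow> 'a set" where
  "set_pow G I 0 = {\<one>\<^bsub>G\<^esub>}"
| "set_pow G I (Suc n) = set_mult G I (set_pow G I n)"

definition r_Krull_intersection :: "('a, 'b) monoid_scheme \<Rightarrow> 'a set \<Rightarrow> ('a set \<Rightarrow> 'a set) \<Rightarrow> bool" where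
  "r_Krull_intersection G H r \<longleftrightarrow>
     (\<forall>I \<in> r_ideals H r - {H}. (\<Inter>n. r (set_pow G I n)) = {})"

definition prime_r_ideal :: "('a, 'b) monoid_scheme \<Rightarrow> 'a set \<Rightarrow> ('a set \<Rightarrow> 'a set) \<Rightarrow> 'a set \<Rightarrow> bool" where
  "prime_r_ideal G H r P \<longleftrightarrow> r_ideal H r P \<and> P \<noteq> H \<and>
     (\<forall>a\<in>H. \<forall>b\<in>H. a \<otimes>\<^bsub>G\<^esub> b \<in> P \<longrightarrow> a \<in> P \<or> b \<in> P)"

definition atom :: "('a, 'b) monoid_scheme \<Rightarrow> 'a \<Rightarrow> bool" where
  "atom M u \<longleftrightarrow> u \<in> carrier M \<and> u \<notin> Units M \<and>
     (\<forall>b\<in>carrier M. \<forall>c\<in>carrier M. u = b \<otimes>\<^bsub>M\<^esub> c \<longrightarrow> b \<in> Units M \<or> c \<in> Units M)"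

definition lengths :: "('a, 'b) monoid_scheme \<Rightarrow> 'a \<Rightarrow> nat set" where
  "lengths M a = {length us | us. \<exists>\<epsilon>\<in>Units M. (\<forall>u\<in>set us. atom M u) \<and>
                     a = \<epsilon> \<otimes>\<^bsub>M\<^esub> foldr (\<otimes>\<^bsub>M\<^esub>) us \<one>\<^bsub>M\<^esub>}"

definition system_of_lengths :: "('a, 'b) monoid_scheme \<Rightarrow> nat set set" where
  "system_of_lengths M = lengths M ` carrier M"

text \<open>\<rho>(L) = sup L / min L, with \<rho>({0}) = 1 (and, by convention, \<rho>(\<emptyset>) = 1).\<close>
definition rho_set :: "nat set \<Rightarrow> ereal" where
  "rho_set L = (if L \<subseteq> {0} then 1
                else (SUP l\<in>L. ereal (real l)) / ereal (real (Inf L)))"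

definition elasticity :: "('a, 'b) monoid_scheme \<Rightarrow> ereal" where
  "elasticity M = (SUP L \<in> system_of_lengths M. rho_set L)"

definition accepted_elasticity :: "('a, 'b) monoid_scheme \<Rightarrow> bool" where
  "accepted_elasticity M \<longleftrightarrow> (\<exists>L\<in>system_of_lengths M. rho_set L = elasticity M)"

definition fully_elastic :: "('a, 'b) monoid_scheme \<Rightarrow> bool" where
  "fully_elastic M \<longleftrightarrow> (\<forall>q::rat. 1 < q \<and> ereal (of_rat q) < elasticity M
      \<longrightarrow> (\<exists>L\<in>system_of_lengths M. rho_set L = ereal (of_rat q)))"

definition div_closed_gen :: "('a, 'b) monoid_scheme \<Rightarrow> 'a \<Rightarrow> 'a set" where
  "div_closed_gen M a = {b \<in> carrier M. \<exists>n::nat. b divides\<^bsub>M\<^esub> (a [^]\<^bsub>M\<^esub> n)}"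

definition div_closed_submonoid :: "('a, 'b) monoid_scheme \<Rightarrow> 'a \<Rightarrow> ('a, 'b) monoid_scheme" where
  "div_closed_submonoid M a = M\<lparr>carrier := div_closed_gen M a\<rparr>"

text \<open>A monoid is finitely generated modulo units if there is a finite set E such that every
  element is a unit times a finite product of elements of E (i.e. M_red is generated by the
  image of E).\<close>
definition fin_gen_mod_units :: "('a, 'b) monoid_scheme \<Rightarrow> bool" where
  "fin_gen_mod_units M \<longleftrightarrow> (\<exists>E. finite E \<and> E \<subseteq> carrier M \<and>
     (\<forall>x\<in>carrier M. \<exists>\<epsilon>\<in>Units M. \<exists>es. set es \<subseteq> E \<and> x = \<epsilon> \<otimes>\<^bsub>M\<^esub> foldr (\<otimes>\<^bsub>M\<^esub>) es \<one>\<^bsub>M\<^esub>))"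

definition locally_finitely_generated :: "('a, 'b) monoid_scheme \<Rightarrow> bool" where
  "locally_finitely_generated M \<longleftrightarrow>
     (\<forall>a\<in>carrier M. fin_gen_mod_units (div_closed_submonoid M a))"

end

theory Submission
  imports Defs
begin

text \<open>
  If \<open>b\<close> realises the largest elasticity among its own powers and \<open>p\<close> is a cancellable prime element,
  then the products \<open>p\<^sup>k b\<^sup>j\<close> realise every rational number between \<open>1\<close> and the elasticity of \<open>b\<close>.
  Such a \<open>b\<close> comes from accepted elasticity of the monoid or of the divisor-closed submonoid of a given
  element; for finitely generated submonoids acceptance follows from Dickson's lemma. All this needs finite
  sets of lengths. For \<open>r\<close>-invertible \<open>r\<close>-ideals these follow from the ascending chain condition
  on ideal quotients, and for all \<open>r\<close>-ideals from Krull's intersection theorem at the finitely many maximal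
  \<open>r\<close>-ideals above a given element. An \<open>r\<close>-invertible \<open>r\<close>-ideal divides exactly the \<open>r\<close>-ideals it contains,
  so an \<open>r\<close>-invertible prime \<open>r\<close>-ideal is a cancellable prime element.
\<close>

section \<open>Factorizations in reduced commutative monoids\<close>

text \<open>The monoid of all \<open>r\<close>-ideals is in general not cancellative, so the
  elasticity argument may cancel only the prime \<open>p\<close>; full cancellation enters for
  \<open>r\<close>-invertible ideals alone, in the Dickson argument and in the bound on lengths.
  Both monoids are reduced, since a product of \<open>r\<close>-ideals lies in each factor; hence
  the unit in a factorization is always the identity. A power of an element can have larger
  elasticity than the element itself. This is why an \<open>a\<close> with elasticity above
  \<open>q\<close> has to be replaced by a \<open>b\<close> on whose powers the ratio does not grow:
  only then are the extreme lengths of \<open>b [^] j\<close> equal to \<open>j\<close> times those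
  of \<open>b\<close>. Finite length sets are the deeper obstacle. The chain condition on principal
  ideals yields only the existence of factorizations into atoms, not a bound on their lengths. What
  \<open>r_noetherian\<close> gives the invertible ideals is the chain condition on divisorial
  ideals, so their monoid is a Mori monoid; the bound then comes from an argument with associated
  primes.\<close>

locale reduced_comm_monoid = comm_monoid M for M (structure) +
  assumes reduced: "x \<in> carrier M \<Longrightarrow> y \<in> carrier M \<Longrightarrow> x \<otimes> y = \<one> \<Longrightarrow> x = \<one>"
begin

abbreviation mprod :: "'a list \<Rightarrow> 'a" where
  "mprod us \<equiv> foldr (\<otimes>) us \<one>"

lemma Units_reduced: "Units M = {\<one>}"
  using reduced by (auto simp: Units_def)

lemma mprod_append:
  "set us \<subseteq> carrier M \<Longrightarrow> set vs \<subseteq> carrier M \<Longrightarrow> mprod (us @ vs) = mprod us \<otimes> mprod vs"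
  by (induction us) (auto simp: m_assoc)

lemma mprod_mset_cong: "set us \<subseteq> carrier M \<Longrightarrow> mset us = mset vs \<Longrightarrow> mprod us = mprod vs"
  by (rule multlist_perm_cong) auto

lemma mprod_split:
  assumes "set us \<subseteq> carrier M"
  shows "mprod us = mprod (filter Q us) \<otimes> mprod (filter (\<lambda>x. \<not> Q x) us)"
proof -
  have "mprod us = mprod (filter Q us @ filter (\<lambda>x. \<not> Q x) us)"
    using assms by (intro mprod_mset_cong) auto
  also have "\<dots> = mprod (filter Q us) \<otimes> mprod (filter (\<lambda>x. \<not> Q x) us)"
    using assms by (intro mprod_append) auto
  finally show ?thesis .
qed

lemma mprod_remove1:
  assumes "set us \<subseteq> carrier M" "u \<in> set us"
  shows "mprod us = u \<otimes> mprod (remove1 u us)"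
proof -
  have "mprod us = mprod (u # remove1 u us)"
    using assms by (intro mprod_mset_cong) auto
  then show ?thesis by simp
qed

lemma mprod_eq_one:
  "set us \<subseteq> carrier M - {\<one>} \<Longrightarrow> mprod us = \<one> \<Longrightarrow> us = []"
proof (cases us)
  case (Cons u vs)
  assume "set us \<subseteq> carrier M - {\<one>}" "mprod us = \<one>"
  moreover from this have "set vs \<subseteq> carrier M" using Cons by auto
  ultimately show ?thesis using reduced[of u "mprod vs"] Cons by simp
qed

lemma atom_iff:
  "atom M u \<longleftrightarrow> u \<in> carrier M \<and> u \<noteq> \<one> \<and>
     (\<forall>b\<in>carrier M. \<forall>c\<in>carrier M. u = b \<otimes> c \<longrightarrow> b = \<one> \<or> c = \<one>)"
  by (auto simp: atom_def Units_reduced)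

lemma atoms_nonunits: "\<forall>u\<in>set us. atom M u \<Longrightarrow> set us \<subseteq> carrier M - {\<one>}"
  by (auto simp: atom_iff)

lemma atoms_carrier: "\<forall>u\<in>set us. atom M u \<Longrightarrow> set us \<subseteq> carrier M"
  by (auto simp: atom_iff)

lemma lengths_iff:
  "n \<in> lengths M a \<longleftrightarrow> (\<exists>us. n = length us \<and> (\<forall>u\<in>set us. atom M u) \<and> a = mprod us)"
proof -
  have "(\<exists>\<epsilon>\<in>Units M. (\<forall>u\<in>set us. atom M u) \<and> a = \<epsilon> \<otimes> mprod us)
          \<longleftrightarrow> (\<forall>u\<in>set us. atom M u) \<and> a = mprod us" for us
    using atoms_carrier[of us] multlist_closed[of us] by (auto simp: Units_reduced)
  then show ?thesis unfolding lengths_def by auto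
qed

lemma lengths_one: "lengths M \<one> = {0}"
proof -
  have "us = []" if "\<forall>u\<in>set us. atom M u" "\<one> = mprod us" for us
    using mprod_eq_one atoms_nonunits that by metis
  then show ?thesis
    by (force simp: set_eq_iff lengths_iff)
qed

lemma zero_in_lengths: "0 \<in> lengths M a \<Longrightarrow> a = \<one>"
  by (auto simp: lengths_iff)

lemma lengths_mult:
  "m \<in> lengths M a \<Longrightarrow> n \<in> lengths M b \<Longrightarrow> m + n \<in> lengths M (a \<otimes> b)"
  unfolding lengths_iff
proof (elim exE conjE)
  fix us vs
  assume h: "m = length us" "\<forall>u\<in>set us. atom M u" "a = mprod us"
            "n = length vs" "\<forall>u\<in>set vs. atom M u" "b = mprod vs"
  then show "\<exists>ws. m + n = length ws \<and> (\<forall>u\<in>set ws. atom M u) \<and> a \<otimes> b = mprod ws"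
    using atoms_carrier[of us] atoms_carrier[of vs]
    by (intro exI[of _ "us @ vs"]) (auto simp: mprod_append simp del: foldr_append)
qed

lemma lengths_pow:
  assumes "a \<in> carrier M" "n \<in> lengths M a"
  shows "j * n \<in> lengths M (a [^] (j::nat))"
proof (induction j)
  case (Suc j)
  then show ?case using lengths_mult[OF Suc assms(2)] by (simp add: add.commute)
qed (simp add: lengths_one)

text \<open>Every factorization of \<open>p \<otimes> a\<close> contains \<open>p\<close> itself:
  \<open>p\<close> divides one of its atoms, and an atom of the form \<open>p \<otimes> d\<close>
  has \<open>d = \<one>\<close>. Removing \<open>p\<close> and cancelling it leaves a factorization
  of \<open>a\<close>. That \<open>p\<close> is an atom also rests on cancelling
  \<open>p\<close>.\<close>

lemma lengths_prime_mult:
  assumes p: "p \<in> carrier M" "prime M p"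
    and canc: "inj_on ((\<otimes>) p) (carrier M)"
    and a: "a \<in> carrier M"
  shows "lengths M (p \<otimes> a) = Suc ` lengths M a"
proof -
  have p1: "p \<noteq> \<one>" using p(2) by (auto simp: prime_def Units_reduced)
  have pdvd: "p divides b \<or> p divides c"
    if "p divides (b \<otimes> c)" "b \<in> carrier M" "c \<in> carrier M" for b c
    using p(2) that by (auto simp: prime_def)
  have half: "c = \<one>" if p': "p = b \<otimes> c" "p divides b" and bc: "b \<in> carrier M" "c \<in> carrier M" for b c
  proof -
    obtain d where d: "d \<in> carrier M" "b = p \<otimes> d" using p'(2) by (auto simp: factor_def)
    have "p \<otimes> (d \<otimes> c) = p \<otimes> \<one>" using p'(1) d bc p(1) by (simp add: m_assoc)
    then have "d \<otimes> c = \<one>" using inj_onD[OF canc] d bc by auto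
    then show ?thesis using reduced[of c d] d bc m_comm by auto
  qed
  have atom: "atom M p"
    unfolding atom_iff
  proof (intro conjI ballI impI)
    fix b c assume bc: "b \<in> carrier M" "c \<in> carrier M" "p = b \<otimes> c"
    have "p divides (b \<otimes> c)" using bc p(1) by (metis divides_refl)
    then have "p divides b \<or> p divides c" using pdvd bc by auto
    then show "b = \<one> \<or> c = \<one>"
      using half[of b c] half[of c b] bc m_comm by auto
  qed (use p p1 in auto)
  have "p \<in> set us" if "p divides mprod us" "\<forall>u\<in>set us. atom M u" for us
    using that
  proof (induction us)
    case Nil
    then obtain c where "c \<in> carrier M" "\<one> = p \<otimes> c" by (auto simp: factor_def)
    then show ?case using reduced[of p c] p(1) p1 by simp
  next
    case (Cons u us)
    have c: "u \<in> carrier M" "set us \<subseteq> carrier M" using Cons.prems(2) by (auto simp: atom_iff)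
    then consider "p divides u" | "p divides mprod us"
      using pdvd[of u "mprod us"] Cons.prems(1) by auto
    then show ?case
    proof cases
      case 1
      then obtain d where "d \<in> carrier M" "u = p \<otimes> d" by (auto simp: factor_def)
      then have "d = \<one>" using Cons.prems(2) p(1) p1 by (auto simp: atom_iff)
      then show ?thesis using \<open>u = p \<otimes> d\<close> p(1) by simp
    next
      case 2
      then show ?thesis using Cons by simp
    qed
  qed
  then have mem: "p \<in> set us" if "p \<otimes> a = mprod us" "\<forall>u\<in>set us. atom M u" for us
    using that a by (metis dividesI')
  show ?thesis
  proof
    show "lengths M (p \<otimes> a) \<subseteq> Suc ` lengths M a"
    proof
      fix n assume "n \<in> lengths M (p \<otimes> a)"
      then obtain us where us: "n = length us" "\<forall>u\<in>set us. atom M u" "p \<otimes> a = mprod us"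
        by (auto simp: lengths_iff)
      have pu: "p \<in> set us" using mem us by auto
      have uc: "set us \<subseteq> carrier M" using us(2) by (auto simp: atom_iff)
      have rc: "set (remove1 p us) \<subseteq> set us" by (rule set_remove1_subset)
      have "p \<otimes> a = p \<otimes> mprod (remove1 p us)"
        using mprod_remove1[OF uc pu] us(3) by simp
      then have "a = mprod (remove1 p us)"
        by (rule inj_onD[OF canc]) (use a multlist_closed[of "remove1 p us"] uc rc in blast)+
      then have "length (remove1 p us) \<in> lengths M a"
        unfolding lengths_iff using us(2) rc by blast
      moreover have "n = Suc (length (remove1 p us))"
        using length_pos_if_in_set[OF pu] by (simp add: length_remove1 us(1) pu)
      ultimately show "n \<in> Suc ` lengths M a" by blast
    qed
    show "Suc ` lengths M a \<subseteq> lengths M (p \<otimes> a)"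
    proof (auto simp: lengths_iff)
      fix us assume "\<forall>u\<in>set us. atom M u"
      then show "\<exists>vs. Suc (length us) = length vs \<and> (\<forall>u\<in>set vs. atom M u) \<and> p \<otimes> mprod us = mprod vs"
        using atom by (intro exI[of _ "p # us"]) auto
    qed
  qed
qed

lemma lengths_prime_pow_mult:
  assumes p: "p \<in> carrier M" "prime M p"
    and canc: "inj_on ((\<otimes>) p) (carrier M)"
    and a: "a \<in> carrier M"
  shows "lengths M (p [^] (k::nat) \<otimes> a) = (\<lambda>n. n + k) ` lengths M a"
proof (induction k)
  case 0
  then show ?case using a by simp
next
  case (Suc k)
  have "p [^] Suc k \<otimes> a = p \<otimes> (p [^] k \<otimes> a)"
    using p(1) a by (simp add: m_comm m_lcomm m_assoc)
  then show ?case
    using lengths_prime_mult[OF p canc, of "p [^] k \<otimes> a"] Suc a p(1) by (simp add: image_image)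
qed

end

text \<open>A bound for factorizations into arbitrary non-units, not just into atoms, makes sets of
  lengths nonempty as well as finite.\<close>

locale bf_monoid = reduced_comm_monoid +
  assumes bounded: "a \<in> carrier M \<Longrightarrow>
    \<exists>n. \<forall>us. set us \<subseteq> carrier M - {\<one>} \<longrightarrow> mprod us = a \<longrightarrow> length us \<le> n"
begin

lemma lengths_finite: "a \<in> carrier M \<Longrightarrow> finite (lengths M a)"
proof -
  assume "a \<in> carrier M"
  then obtain n where n: "\<And>us. set us \<subseteq> carrier M - {\<one>} \<Longrightarrow> mprod us = a \<Longrightarrow> length us \<le> n"
    using bounded by meson
  then have "lengths M a \<subseteq> {..n}"
    using atoms_nonunits by (auto simp: lengths_iff)
  then show ?thesis by (rule finite_subset) simp
qed

text \<open>A factorization into non-units of maximal length consists of atoms.\<close>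

lemma lengths_nonempty:
  assumes a: "a \<in> carrier M"
  shows "lengths M a \<noteq> {}"
proof -
  obtain n where n: "\<And>us. set us \<subseteq> carrier M - {\<one>} \<Longrightarrow> mprod us = a \<Longrightarrow> length us \<le> n"
    using bounded[OF a] by meson
  let ?P = "\<lambda>k. \<exists>us. set us \<subseteq> carrier M - {\<one>} \<and> mprod us = a \<and> length us = k"
  have ex: "\<exists>k. ?P k"
  proof (cases "a = \<one>")
    case True
    then show ?thesis by (intro exI[of _ 0] exI[of _ "[]"]) simp
  next
    case False
    then show ?thesis using a by (intro exI[of _ "Suc 0"] exI[of _ "[a]"]) simp
  qed
  have "?P (Greatest ?P)"
    using ex by (elim exE, intro GreatestI_nat[of ?P _ n]) (use n in auto)
  then obtain us where us: "set us \<subseteq> carrier M - {\<one>}" "mprod us = a" "length us = Greatest ?P" by auto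
  have "atom M u" if "u \<in> set us" for u
    unfolding atom_iff
  proof (intro conjI ballI impI)
    fix b c assume bc: "b \<in> carrier M" "c \<in> carrier M" "u = b \<otimes> c"
    show "b = \<one> \<or> c = \<one>"
    proof (rule ccontr)
      assume "\<not> (b = \<one> \<or> c = \<one>)"
      have rc: "set (remove1 u us) \<subseteq> set us" by (rule set_remove1_subset)
      have "mprod (b # c # remove1 u us) = a"
        using mprod_remove1[of us u] us(1,2) that bc rc
        by (subst us(2)[symmetric]) (auto simp: m_assoc subset_iff)
      moreover have "set (b # c # remove1 u us) \<subseteq> carrier M - {\<one>}"
        using bc us(1) rc \<open>\<not> (b = \<one> \<or> c = \<one>)\<close> by auto
      moreover have "length (b # c # remove1 u us) = Suc (length us)"
        using length_pos_if_in_set[OF that] by (simp add: length_remove1 that)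
      ultimately have "?P (Suc (length us))" by metis
      then have "Suc (length us) \<le> Greatest ?P"
        by (rule Greatest_le_nat[of ?P _ n]) (use n in auto)
      then show False using us(3) by simp
    qed
  qed (use that us(1) in auto)
  then have "length us \<in> lengths M a" unfolding lengths_iff using us(2) by blast
  then show ?thesis by blast
qed

text \<open>A real number suffices since length sets are finite here; the value at
  \<open>\<one>\<close> copies the convention for the length set {0}.\<close>

definition ratio :: "'a \<Rightarrow> real" where
  "ratio a = (if a = \<one> then 1 else real (Max (lengths M a)) / real (Min (lengths M a)))"

lemma rho_set_lengths:
  assumes a: "a \<in> carrier M"
  shows "rho_set (lengths M a) = ereal (ratio a)"
proof (cases "a = \<one>")
  case True
  then show ?thesis by (simp add: rho_set_def lengths_one ratio_def one_ereal_def)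
next
  case False
  let ?L = "lengths M a"
  have L: "finite ?L" "?L \<noteq> {}" "0 \<notin> ?L"
    using lengths_finite lengths_nonempty zero_in_lengths a False by auto
  have "(SUP l\<in>?L. ereal (real l)) = ereal (real (Max ?L))"
    using L by (intro SUP_eqI) auto
  moreover have "Inf ?L = Min ?L" using L by (intro cInf_eq_Min) auto
  ultimately show ?thesis
    using L False by (auto simp: rho_set_def ratio_def Min_gr_iff intro: gr0I)
qed

lemma Min_lengths_pos: "a \<in> carrier M \<Longrightarrow> a \<noteq> \<one> \<Longrightarrow> 0 < Min (lengths M a)"
  using lengths_finite lengths_nonempty zero_in_lengths by (metis Min_in gr0I)

lemma ratio_ge_one: "a \<in> carrier M \<Longrightarrow> 1 \<le> ratio a"
proof -
  assume a: "a \<in> carrier M"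
  then have "Min (lengths M a) \<le> Max (lengths M a)"
    using lengths_finite lengths_nonempty by (meson Max_ge Min_in)
  then show ?thesis using Min_lengths_pos[OF a] by (auto simp: ratio_def)
qed

lemma elasticity_eq: "elasticity M = (SUP a\<in>carrier M. ereal (ratio a))"
  by (simp add: elasticity_def system_of_lengths_def image_image rho_set_lengths)

lemma accepted_elasticity_iff:
  "accepted_elasticity M \<longleftrightarrow> (\<exists>b\<in>carrier M. \<forall>a\<in>carrier M. ratio a \<le> ratio b)"
proof -
  have "accepted_elasticity M \<longleftrightarrow> (\<exists>b\<in>carrier M. ereal (ratio b) = (SUP a\<in>carrier M. ereal (ratio a)))"
    by (auto simp: accepted_elasticity_def system_of_lengths_def rho_set_lengths elasticity_eq)
  also have "\<dots> \<longleftrightarrow> (\<exists>b\<in>carrier M. \<forall>a\<in>carrier M. ratio a \<le> ratio b)"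
  proof (intro bex_cong refl)
    fix b assume b: "b \<in> carrier M"
    have "ereal (ratio b) = (SUP a\<in>carrier M. ereal (ratio a))
           \<longleftrightarrow> (SUP a\<in>carrier M. ereal (ratio a)) \<le> ereal (ratio b)"
      using b by (auto intro: antisym SUP_upper)
    then show "ereal (ratio b) = (SUP a\<in>carrier M. ereal (ratio a))
           \<longleftrightarrow> (\<forall>a\<in>carrier M. ratio a \<le> ratio b)"
      by (simp add: SUP_le_iff)
  qed
  finally show ?thesis .
qed

text \<open>If the elasticity of \<open>b\<close> is not exceeded by that of its powers, then the longest and shortest
  factorizations of \<open>b [^] j\<close> are the obvious ones, and multiplying by \<open>p [^] k\<close> shifts both lengths
  by \<open>k\<close>. For \<open>q = s / t\<close> and \<open>m\<close>, \<open>n\<close> the maximal and minimal length of \<open>b\<close>, the values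
  \<open>j = s - t\<close> and \<open>k = t * m - s * n\<close> solve \<open>(j * m + k) / (j * n + k) = s / t\<close>.\<close>

lemma ratio_attained:
  assumes p: "p \<in> carrier M" "prime M p"
    and canc: "inj_on ((\<otimes>) p) (carrier M)"
    and b: "b \<in> carrier M" and pow: "\<And>j::nat. ratio (b [^] j) \<le> ratio b"
    and q: "1 < q" "of_rat q < ratio b"
  shows "\<exists>c\<in>carrier M. ratio c = of_rat q"
proof -
  have "b \<noteq> \<one>" using q by (auto simp: ratio_def)
  obtain s t where st: "quotient_of q = (s, t)" by (cases "quotient_of q")
  have t: "t > 0" using quotient_of_denom_pos[OF st] .
  have q_eq: "q = of_int s / of_int t" using quotient_of_div[OF st] .
  have "t < s" using q(1) t by (simp add: q_eq less_divide_eq)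
  define m where "m = Max (lengths M b)"
  define n where "n = Min (lengths M b)"
  have n0: "0 < n" using Min_lengths_pos b \<open>b \<noteq> \<one>\<close> by (simp add: n_def)
  have mL: "m \<in> lengths M b" "n \<in> lengths M b"
    using lengths_finite[OF b] lengths_nonempty[OF b] by (auto simp: m_def n_def)
  have rb: "ratio b = m / n" using \<open>b \<noteq> \<one>\<close> by (simp add: ratio_def m_def n_def)
  have "real_of_int s / real_of_int t < m / n"
    using q(2) by (simp add: q_eq rb of_rat_divide)
  then have "real_of_int (s * n) < real_of_int (t * m)"
    using t n0 by (simp add: field_simps)
  then have stmn: "s * n < t * m" by linarith
  \<comment> \<open>Both differences are positive, so \<open>nat\<close> truncates nothing:
    \<open>t < s\<close> expresses 1 < q, and \<open>s * n < t * m\<close> expresses q < m /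
    n.\<close>
  define j where "j = nat (s - t)"
  define k where "k = nat (t * m - s * n)"
  have j: "int j = s - t" "0 < j" and k: "int k = t * m - s * n"
    using \<open>t < s\<close> stmn by (auto simp: j_def k_def)
  let ?B = "b [^] j"
  have Bc: "?B \<in> carrier M" using b by simp
  have jL: "j * m \<in> lengths M ?B" "j * n \<in> lengths M ?B"
    using lengths_pow[OF b] mL by auto
  have B1: "?B \<noteq> \<one>" using jL(2) j n0 by (auto simp: lengths_one)
  have fin: "finite (lengths M ?B)" using lengths_finite Bc by blast
  define m' where "m' = Max (lengths M ?B)"
  define n' where "n' = Min (lengths M ?B)"
  have ge: "j * m \<le> m'" "n' \<le> j * n"
    using fin jL by (auto simp: m'_def n'_def)
  have n'0: "0 < n'" using Min_lengths_pos[OF Bc B1] by (simp add: n'_def)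
  have "real m' / real n' \<le> m / n" using pow[of j] B1 unfolding rb by (simp add: ratio_def m'_def n'_def)
  then have "real (m' * n) \<le> real (m * n')" using n0 n'0 by (simp add: field_simps)
  then have le: "m' * n \<le> m * n'" by linarith
  have m0: "0 < m" using stmn t n0 \<open>t < s\<close> by (cases m) (auto simp: mult_less_0_iff)
  \<comment> \<open>The chain j m n \<le> m' n \<le> m n' \<le> m j n has equal ends, so equality
    holds throughout.\<close>
  have eq: "m' = j * m" "n' = j * n"
  proof -
    have "m * n' \<le> m * (j * n)" using ge(2) by (rule mult_le_mono2)
    moreover have "(j * m) * n \<le> m' * n" using ge(1) by (rule mult_le_mono1)
    moreover have "(j * m) * n = m * (j * n)" by simp
    ultimately have "m' * n = (j * m) * n" "m * n' = m * (j * n)"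
      using le by linarith+
    then show "m' = j * m" "n' = j * n" using n0 m0 by auto
  qed
  let ?c = "p [^] k \<otimes> ?B"
  have cc: "?c \<in> carrier M" using p b by simp
  have L: "lengths M ?c = (\<lambda>i. i + k) ` lengths M ?B"
    using lengths_prime_pow_mult[OF p canc Bc] by blast
  have ne: "lengths M ?B \<noteq> {}" using jL by auto
  have "mono (\<lambda>i::nat. i + k)" by (simp add: mono_def)
  then have "Max (lengths M ?c) = m' + k" "Min (lengths M ?c) = n' + k"
    unfolding L m'_def n'_def using mono_Max_commute mono_Min_commute fin ne by metis+
  moreover have "?c \<noteq> \<one>"
  proof
    assume "?c = \<one>"
    moreover have "j * n + k \<in> lengths M ?c" using jL by (auto simp: L)
    ultimately show False using j n0 by (simp add: lengths_one)
  qed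
  ultimately have "ratio ?c = real (j * m + k) / real (j * n + k)"
    by (simp add: ratio_def eq)
  also have "\<dots> = real_of_int s / real_of_int t"
  proof -
    have "int (j * m + k) * t = int (j * n + k) * s"
      by (simp add: j k algebra_simps)
    then have "real_of_int (int (j * m + k) * t) = real_of_int (int (j * n + k) * s)" by simp
    then show ?thesis
      using t j n0 by (simp add: frac_eq_eq mult.commute add_pos_nonneg del: of_nat_add of_nat_mult)
  qed
  also have "\<dots> = of_rat q" by (simp add: q_eq of_rat_divide)
  finally show ?thesis using cc by blast
qed

end

section \<open>Accepted elasticity of finitely generated monoids\<close>

text \<open>A monotone subsequence exists in any case; if it decreases, it is constant from the
  place where it takes its least value.\<close>

lemma mono_subseq_nat:
  fixes s :: "nat \<Rightarrow> nat"
  shows "\<exists>\<phi>::nat \<Rightarrow> nat. strict_mono \<phi> \<and> mono (\<lambda>n. s (\<phi> n))"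
proof -
  obtain \<psi> :: "nat \<Rightarrow> nat" where \<psi>: "strict_mono \<psi>" "monoseq (\<lambda>n. s (\<psi> n))"
    using seq_monosub by blast
  show ?thesis
  proof (cases "incseq (\<lambda>n. s (\<psi> n))")
    case True
    then show ?thesis using \<psi>(1) by blast
  next
    case False
    then have dec: "decseq (\<lambda>n. s (\<psi> n))" using \<psi>(2) by (simp add: monoseq_iff)
    obtain N where N: "\<And>n. s (\<psi> N) \<le> s (\<psi> n)"
      using ex_has_least_nat[of "\<lambda>_. True" _ "\<lambda>n. s (\<psi> n)"] by auto
    have "s (\<psi> (N + n)) = s (\<psi> N)" for n
      using N[of "N + n"] decseqD[OF dec, of N "N + n"] by simp
    moreover have "strict_mono (\<lambda>n. \<psi> (N + n))"
      using \<psi>(1) by (simp add: strict_mono_def)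
    ultimately show ?thesis by (intro exI[of _ "\<lambda>n. \<psi> (N + n)"]) (simp add: mono_def)
  qed
qed

text \<open>One coordinate is treated at a time; passing to a further subsequence keeps the earlier
  coordinates monotone.\<close>

lemma dickson_sequence:
  fixes f :: "nat \<Rightarrow> 'e \<Rightarrow> nat"
  assumes "finite E"
  shows "\<exists>\<phi>::nat \<Rightarrow> nat. strict_mono \<phi> \<and> (\<forall>e\<in>E. mono (\<lambda>n. f (\<phi> n) e))"
  using assms
proof (induction E)
  case empty
  then show ?case by (intro exI[of _ id]) (simp add: strict_mono_def)
next
  case (insert e E)
  then obtain \<phi> :: "nat \<Rightarrow> nat" where \<phi>: "strict_mono \<phi>" "\<forall>e\<in>E. mono (\<lambda>n. f (\<phi> n) e)" by auto
  obtain \<psi> :: "nat \<Rightarrow> nat" where \<psi>: "strict_mono \<psi>" "mono (\<lambda>n. f (\<phi> (\<psi> n)) e)"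
    using mono_subseq_nat[of "\<lambda>n. f (\<phi> n) e"] by auto
  have "mono (\<lambda>n. f (\<phi> (\<psi> n)) d)" if "d \<in> E" for d
    using \<phi>(2) that strict_mono_mono[OF \<psi>(1)] by (auto simp: mono_def)
  moreover have "strict_mono (\<lambda>n. \<phi> (\<psi> n))"
    using \<phi>(1) \<psi>(1) by (simp add: strict_mono_def)
  ultimately show ?case using \<psi>(2) by (intro exI[of _ "\<lambda>n. \<phi> (\<psi> n)"]) auto
qed

lemma dickson_multiset_pairs:
  fixes A :: "('e multiset \<times> 'e multiset) set"
  assumes E: "finite E" and A: "infinite A"
    and sub: "\<And>p. p \<in> A \<Longrightarrow> set_mset (fst p) \<subseteq> E \<and> set_mset (snd p) \<subseteq> E"
  shows "\<exists>p\<in>A. \<exists>q\<in>A. p \<noteq> q \<and> fst p \<subseteq># fst q \<and> snd p \<subseteq># snd q"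
proof -
  obtain g :: "nat \<Rightarrow> 'e multiset \<times> 'e multiset" where g: "inj g" "range g \<subseteq> A"
    using infinite_countable_subset[OF A] by blast
  \<comment> \<open>Both multisets are read as one exponent vector indexed by the disjoint sum
    \<open>E <+> E\<close>, so that the result on single vectors covers pairs.\<close>
  define f where "f n e = (case e of Inl x \<Rightarrow> count (fst (g n)) x | Inr x \<Rightarrow> count (snd (g n)) x)" for n e
  obtain \<phi> :: "nat \<Rightarrow> nat" where \<phi>: "strict_mono \<phi>" "\<forall>e\<in>E <+> E. mono (\<lambda>n. f (\<phi> n) e)"
    using dickson_sequence[of "E <+> E" f] E by auto
  have "f (\<phi> 0) e \<le> f (\<phi> 1) e" if "e \<in> E <+> E" for e
    using \<phi>(2) that by (auto simp: mono_def)
  from this[of "Inl x" for x] this[of "Inr x" for x]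
  have le: "count (fst (g (\<phi> 0))) x \<le> count (fst (g (\<phi> 1))) x"
      "count (snd (g (\<phi> 0))) x \<le> count (snd (g (\<phi> 1))) x" if "x \<in> E" for x
    using that by (auto simp: f_def)
  have "fst (g (\<phi> 0)) \<subseteq># fst (g (\<phi> 1))" "snd (g (\<phi> 0)) \<subseteq># snd (g (\<phi> 1))"
    unfolding subseteq_mset_def
    using le sub[of "g (\<phi> 0)"] g(2) by (metis count_eq_zero_iff le0 rangeI subsetD)+
  moreover have "g (\<phi> 0) \<noteq> g (\<phi> 1)"
    using g(1) \<phi>(1) by (metis injD strict_mono_eq zero_neq_one)
  ultimately show ?thesis using g(2) by blast
qed

section \<open>Minimal pairs of factorizations\<close>

locale bf_monoid_cancel = bf_monoid + comm_monoid_cancel M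
begin

text \<open>The pairs of factorizations of a common element are closed under differences, so each of them
  is a sum of minimal ones. There are only finitely many minimal pairs, and by the mediant
  inequality one of them has the largest ratio of lengths.\<close>

lemma accepted_elasticity_if_fin_gen:
  assumes "fin_gen_mod_units M"
  shows "accepted_elasticity M"
proof (cases "\<exists>u. atom M u")
  case False
  have "a = \<one>" if a: "a \<in> carrier M" for a
  proof -
    obtain n where "n \<in> lengths M a" using lengths_nonempty[OF a] by blast
    then obtain us where "\<forall>u\<in>set us. atom M u" "a = mprod us" by (auto simp: lengths_iff)
    then show ?thesis using False by (cases us) auto
  qed
  then show ?thesis unfolding accepted_elasticity_iff by (metis one_closed order_refl)
next
  case True
  then obtain u0 where u0: "atom M u0" by blast
  obtain E where E: "finite E" "E \<subseteq> carrier M"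
    and gen: "\<And>x. x \<in> carrier M \<Longrightarrow> \<exists>\<epsilon>\<in>Units M. \<exists>es. set es \<subseteq> E \<and> x = \<epsilon> \<otimes> mprod es"
    using assms unfolding fin_gen_mod_units_def by blast
  \<comment> \<open>An atom written as a product of generators equals one of them, all others being
    \<open>\<one>\<close>. Hence there are only finitely many atoms, as Dickson's lemma
    requires.\<close>
  have atomE: "u \<in> E" if u: "atom M u" for u
  proof -
    have uc: "u \<in> carrier M" "u \<noteq> \<one>" using u by (auto simp: atom_iff)
    obtain es where es: "set es \<subseteq> E" "u = \<one> \<otimes> mprod es"
      using gen[OF uc(1)] by (auto simp: Units_reduced)
    have "set es \<subseteq> carrier M" using es(1) E(2) by blast
    then have "u = mprod es" using es(2) by simp
    then show ?thesis using es(1)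
    proof (induction es)
      case Nil
      then show ?case using uc by simp
    next
      case (Cons e es)
      have c: "e \<in> carrier M" "mprod es \<in> carrier M"
        using Cons.prems(2) E(2) multlist_closed[of es] by auto
      then have "e = \<one> \<or> mprod es = \<one>" using u Cons.prems(1) by (auto simp: atom_iff)
      then show ?case using Cons c by auto
    qed
  qed
  \<comment> \<open>Empty lists are excluded because the pair of empty multisets lies below all
    others and would be the only minimal one.\<close>
  define rel where "rel us vs \<longleftrightarrow> (\<forall>u\<in>set us. atom M u) \<and> (\<forall>u\<in>set vs. atom M u)
      \<and> us \<noteq> [] \<and> vs \<noteq> [] \<and> mprod us = mprod vs" for us vs
  define R where "R = {(mset us, mset vs) | us vs. rel us vs}"
  define Mn where "Mn = {p\<in>R. \<forall>q\<in>R. fst q \<subseteq># fst p \<and> snd q \<subseteq># snd p \<longrightarrow> q = p}"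
  have R_nonempty: "fst p \<noteq> {#}" "snd p \<noteq> {#}" if "p \<in> R" for p
    using that by (auto simp: R_def rel_def)
  have finMn: "finite Mn"
  proof (rule ccontr)
    assume inf: "infinite Mn"
    have "set_mset (fst p) \<subseteq> E \<and> set_mset (snd p) \<subseteq> E" if "p \<in> Mn" for p
      using that atomE by (auto simp: Mn_def R_def rel_def)
    then obtain p q where "p \<in> Mn" "q \<in> Mn" "p \<noteq> q" "fst p \<subseteq># fst q" "snd p \<subseteq># snd q"
      using dickson_multiset_pairs[OF E(1) inf] by blast
    then show False by (auto simp: Mn_def)
  qed
  \<comment> \<open>A single atom paired with itself is minimal, so the maximum of
    \<open>\<rho>\<close> over \<open>Mn\<close> exists.\<close>
  have "({#u0#}, {#u0#}) \<in> Mn"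
  proof -
    have "rel [u0] [u0]" using u0 by (simp add: rel_def)
    then have "({#u0#}, {#u0#}) \<in> R" unfolding R_def by force
    moreover have "q = ({#u0#}, {#u0#})" if "q \<in> R" "fst q \<subseteq># {#u0#}" "snd q \<subseteq># {#u0#}" for q
    proof -
      have "Z = {#u0#}" if "Z \<subseteq># {#u0#}" "Z \<noteq> {#}" for Z
        using that by (metis nonempty_subseteq_mset_eq_single)
      then show ?thesis using that R_nonempty[OF that(1)] by (simp add: prod_eq_iff)
    qed
    ultimately show ?thesis unfolding Mn_def mem_Collect_eq fst_conv snd_conv by blast
  qed
  then have "Mn \<noteq> {}" by blast
  define \<rho> where "\<rho> p = real (size (fst p)) / real (size (snd p))" for p :: "'a multiset \<times> 'a multiset"
  obtain p0 where p0: "p0 \<in> Mn" "\<And>p. p \<in> Mn \<Longrightarrow> \<rho> p \<le> \<rho> p0"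
  proof -
    have "Max (\<rho> ` Mn) \<in> \<rho> ` Mn" using finMn \<open>Mn \<noteq> {}\<close> by simp
    then obtain p where "p \<in> Mn" "\<rho> p = Max (\<rho> ` Mn)" by auto
    then show ?thesis using that[of p] finMn by simp
  qed
  \<comment> \<open>Cancelling the common value of \<open>q\<close> from that of \<open>p\<close>
    shows that the two remainders have equal products. If one remainder is empty, this product is
    \<open>\<one>\<close>, so the other is empty too, against \<open>q \<noteq> p\<close>.\<close>
  have diff: "(fst p - fst q, snd p - snd q) \<in> R"
    if p: "p \<in> R" and q: "q \<in> R" and le: "fst q \<subseteq># fst p" "snd q \<subseteq># snd p" and ne: "q \<noteq> p" for p q
  proof -
    obtain us vs where uv: "p = (mset us, mset vs)" "rel us vs" using p by (auto simp: R_def)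
    obtain us' vs' where uv': "q = (mset us', mset vs')" "rel us' vs'" using q by (auto simp: R_def)
    obtain us2 vs2 where d: "mset us2 = mset us - mset us'" "mset vs2 = mset vs - mset vs'"
      by (metis ex_mset)
    have m: "mset us = mset (us' @ us2)" "mset vs = mset (vs' @ vs2)"
      using d le uv uv' by auto
    have at: "\<forall>u\<in>set us2. atom M u" "\<forall>u\<in>set vs2. atom M u"
             "\<forall>u\<in>set us'. atom M u" "\<forall>u\<in>set vs'. atom M u"
      using mset_eq_setD[OF m(1)] mset_eq_setD[OF m(2)] uv(2) by (auto simp: rel_def)
    note c = at[THEN atoms_carrier]
    have "mprod us = mprod us' \<otimes> mprod us2"
      using mprod_mset_cong[OF _ m(1)] mprod_append[OF c(3,1)] uv(2) atoms_carrier
      unfolding rel_def by metis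
    moreover have "mprod vs = mprod vs' \<otimes> mprod vs2"
      using mprod_mset_cong[OF _ m(2)] mprod_append[OF c(4,2)] uv(2) atoms_carrier
      unfolding rel_def by metis
    ultimately have "mprod us' \<otimes> mprod us2 = mprod us' \<otimes> mprod vs2"
      using uv(2) uv'(2) by (simp add: rel_def)
    then have eq: "mprod us2 = mprod vs2" using l_cancel c by simp
    have "us2 \<noteq> [] \<and> vs2 \<noteq> []"
    proof (rule ccontr)
      assume "\<not> ?thesis"
      then have "us2 = [] \<and> vs2 = []"
        using eq mprod_eq_one[of us2] mprod_eq_one[of vs2] at[THEN atoms_nonunits] by auto
      then show False using m ne uv(1) uv'(1) by simp
    qed
    then have "rel us2 vs2" using at eq by (simp add: rel_def)
    then show ?thesis using d uv(1) uv'(1) unfolding R_def by (metis (mono_tags, lifting) fst_conv mem_Collect_eq snd_conv)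
  qed
  \<comment> \<open>In this form without division, the inequalities for \<open>q\<close> and for the
    difference simply add up. The induction is on the total size of the pair.\<close>
  have bound: "real (size (fst p)) \<le> \<rho> p0 * real (size (snd p))" if "p \<in> R" for p
    using that
  proof (induction "size (fst p) + size (snd p)" arbitrary: p rule: less_induct)
    case less
    show ?case
    proof (cases "p \<in> Mn")
      case True
      then have "\<rho> p \<le> \<rho> p0" by (rule p0(2))
      then show ?thesis
        using R_nonempty[OF less.prems]
        by (simp add: \<rho>_def[of p] pos_divide_le_eq nonempty_has_size[symmetric])
    next
      case False
      then obtain q where q: "q \<in> R" "fst q \<subseteq># fst p" "snd q \<subseteq># snd p" "q \<noteq> p"
        using less.prems by (auto simp: Mn_def)
      let ?d = "(fst p - fst q, snd p - snd q)"
      have d: "?d \<in> R" using diff less.prems q by blast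
      have s: "size (fst p) = size (fst q) + size (fst ?d)" "size (snd p) = size (snd q) + size (snd ?d)"
        using q(2,3) by (auto simp: size_Diff_submset size_mset_mono)
      have pos: "0 < size (fst q)" "0 < size (fst ?d)"
        using R_nonempty(1)[OF q(1)] R_nonempty(1)[OF d]
        by (auto simp: nonempty_has_size[symmetric])
      have "real (size (fst q)) \<le> \<rho> p0 * real (size (snd q))"
        by (rule less.hyps) (use s pos q in linarith, rule q(1))
      moreover have "real (size (fst ?d)) \<le> \<rho> p0 * real (size (snd ?d))"
        by (rule less.hyps) (use s pos in linarith, rule d)
      ultimately show ?thesis unfolding s by (simp add: distrib_left)
    qed
  qed
  obtain us0 vs0 where uv0: "p0 = (mset us0, mset vs0)" "rel us0 vs0"
    using p0(1) by (auto simp: Mn_def R_def)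
  define b where "b = mprod us0"
  have b: "b \<in> carrier M"
    using uv0(2) atoms_carrier[of us0] unfolding b_def rel_def by (intro multlist_closed) blast
  have b1: "b \<noteq> \<one>" using uv0(2) mprod_eq_one[of us0] atoms_nonunits[of us0] by (auto simp: b_def rel_def)
  have L: "length us0 \<in> lengths M b" "length vs0 \<in> lengths M b"
    using uv0(2) unfolding lengths_iff b_def rel_def by auto
  have "\<rho> p0 \<le> ratio b"
  proof -
    have "real (length us0) / real (length vs0) \<le> real (Max (lengths M b)) / real (Min (lengths M b))"
      using L lengths_finite[OF b] Min_lengths_pos[OF b b1] by (intro frac_le) auto
    then show ?thesis using b1 by (simp add: \<rho>_def uv0(1) ratio_def)
  qed
  moreover have "ratio a \<le> \<rho> p0" if a: "a \<in> carrier M" "a \<noteq> \<one>" for a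
  proof -
    have "Max (lengths M a) \<in> lengths M a" "Min (lengths M a) \<in> lengths M a"
      using lengths_finite[OF a(1)] lengths_nonempty[OF a(1)] by auto
    then obtain us vs where us: "Max (lengths M a) = length us" "\<forall>u\<in>set us. atom M u" "a = mprod us"
      and vs: "Min (lengths M a) = length vs" "\<forall>u\<in>set vs. atom M u" "a = mprod vs"
      unfolding lengths_iff by blast
    have "us \<noteq> []" "vs \<noteq> []" using us(3) vs(3) a(2) by auto
    then have "rel us vs" using us vs by (simp add: rel_def)
    then have "(mset us, mset vs) \<in> R" unfolding R_def by blast
    then have "real (length us) \<le> \<rho> p0 * real (length vs)" using bound by fastforce
    then show ?thesis using a(2) us(1) vs(1) \<open>vs \<noteq> []\<close> by (simp add: ratio_def divide_le_eq)
  qed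
  moreover have "ratio \<one> \<le> ratio b" using ratio_ge_one[OF b] by (simp add: ratio_def)
  ultimately have "ratio a \<le> ratio b" if "a \<in> carrier M" for a
    using that by (cases "a = \<one>") (blast, blast intro: order_trans)
  then show ?thesis unfolding accepted_elasticity_iff using b by blast
qed

end

section \<open>Divisor-closed submonoids\<close>

context bf_monoid
begin

lemma div_closed_gen_subset: "div_closed_gen M a \<subseteq> carrier M"
  by (auto simp: div_closed_gen_def)

lemma div_closed_gen_self: "a \<in> carrier M \<Longrightarrow> a \<in> div_closed_gen M a"
  unfolding div_closed_gen_def by (auto intro!: exI[of _ "1::nat"])

lemma div_closed_gen_divisor:
  assumes "b \<otimes> c \<in> div_closed_gen M a" "a \<in> carrier M" "b \<in> carrier M" "c \<in> carrier M"
  shows "b \<in> div_closed_gen M a"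
proof -
  obtain n :: nat where "(b \<otimes> c) divides (a [^] n)" using assms(1) by (auto simp: div_closed_gen_def)
  then have "b divides (a [^] n)"
    using assms by (metis divides_trans dividesI' m_closed)
  then show ?thesis using assms by (auto simp: div_closed_gen_def)
qed

lemma div_closed_gen_submonoid:
  assumes a: "a \<in> carrier M"
  shows "submonoid (div_closed_gen M a) M"
proof
  fix x y assume x: "x \<in> div_closed_gen M a" and y: "y \<in> div_closed_gen M a"
  then obtain m n :: nat where mn: "x divides (a [^] m)" "y divides (a [^] n)"
    by (auto simp: div_closed_gen_def)
  obtain c d where cd: "c \<in> carrier M" "a [^] m = x \<otimes> c" "d \<in> carrier M" "a [^] n = y \<otimes> d"
    using mn by (auto simp: factor_def)
  have xy: "x \<in> carrier M" "y \<in> carrier M" using x y by (auto simp: div_closed_gen_def)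
  have "a [^] (m + n) = (x \<otimes> c) \<otimes> (y \<otimes> d)" using a cd by (simp flip: nat_pow_mult)
  also have "\<dots> = (x \<otimes> y) \<otimes> (c \<otimes> d)" using xy cd by (simp add: m_ac)
  finally have "(x \<otimes> y) divides (a [^] (m + n))" using cd xy by (auto simp: factor_def)
  then show "x \<otimes> y \<in> div_closed_gen M a" using xy unfolding div_closed_gen_def by blast
next
  show "\<one> \<in> div_closed_gen M a"
    unfolding div_closed_gen_def by (auto intro!: exI[of _ "0::nat"])
qed (rule div_closed_gen_subset)

lemma div_closed_simps:
  "carrier (div_closed_submonoid M a) = div_closed_gen M a"
  "monoid.mult (div_closed_submonoid M a) = (\<otimes>)"
  "monoid.one (div_closed_submonoid M a) = \<one>"
  by (simp_all add: div_closed_submonoid_def)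

lemma div_closed_bf_monoid:
  assumes a: "a \<in> carrier M"
  shows "bf_monoid (div_closed_submonoid M a)"
proof -
  interpret D: comm_monoid "div_closed_submonoid M a"
    unfolding div_closed_submonoid_def
    by (rule submonoid_is_comm_monoid[OF div_closed_gen_submonoid[OF a]])
  show ?thesis
  proof (unfold_locales, unfold div_closed_simps)
    show "x = \<one>" if "x \<in> div_closed_gen M a" "y \<in> div_closed_gen M a" "x \<otimes> y = \<one>" for x y
      using that reduced div_closed_gen_subset by blast
    show "\<exists>n. \<forall>us. set us \<subseteq> div_closed_gen M a - {\<one>} \<longrightarrow> mprod us = b \<longrightarrow> length us \<le> n"
      if "b \<in> div_closed_gen M a" for b
      using bounded[of b] that div_closed_gen_subset[of a] by (meson Diff_mono order_refl subsetD subset_trans)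
  qed
qed

text \<open>All factors of an element of a divisor-closed submonoid lie in it again, so atoms and
  factorizations are the same in both monoids.\<close>

lemma lengths_div_closed:
  assumes a: "a \<in> carrier M" and b: "b \<in> div_closed_gen M a"
  shows "lengths (div_closed_submonoid M a) b = lengths M b"
proof -
  interpret D: bf_monoid "div_closed_submonoid M a" by (rule div_closed_bf_monoid[OF a])
  have at: "atom (div_closed_submonoid M a) u \<longleftrightarrow> atom M u" if u: "u \<in> div_closed_gen M a" for u
  proof -
    have "c \<in> div_closed_gen M a \<and> d \<in> div_closed_gen M a"
      if "u = c \<otimes> d" "c \<in> carrier M" "d \<in> carrier M" for c d
      using that u a div_closed_gen_divisor[of c d a] div_closed_gen_divisor[of d c a] m_comm[of c d] by auto
    then show ?thesis
      unfolding D.atom_iff atom_iff div_closed_simps using u div_closed_gen_subset[of a] by blast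
  qed
  have sub: "set us \<subseteq> div_closed_gen M a" if "set us \<subseteq> carrier M" "mprod us \<in> div_closed_gen M a" for us
    using that
  proof (induction us)
    case (Cons u us)
    have c: "u \<in> carrier M" "mprod us \<in> carrier M" using Cons.prems(1) by auto
    have "u \<in> div_closed_gen M a" "mprod us \<in> div_closed_gen M a"
      using Cons.prems(2) c a div_closed_gen_divisor[of u "mprod us" a]
        div_closed_gen_divisor[of "mprod us" u a] m_comm[OF c] by auto
    then show ?case using Cons by simp
  qed simp
  have "(\<forall>u\<in>set us. atom (div_closed_submonoid M a) u) \<longleftrightarrow> (\<forall>u\<in>set us. atom M u)"
    if "b = mprod us" for us
  proof
    assume l: "\<forall>u\<in>set us. atom (div_closed_submonoid M a) u"
    then have "set us \<subseteq> div_closed_gen M a" using D.atoms_carrier by (simp add: div_closed_simps)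
    then show "\<forall>u\<in>set us. atom M u" using at l by blast
  next
    assume r: "\<forall>u\<in>set us. atom M u"
    then have "set us \<subseteq> div_closed_gen M a" using sub atoms_carrier b that by blast
    then show "\<forall>u\<in>set us. atom (div_closed_submonoid M a) u" using at r by blast
  qed
  then show ?thesis
    unfolding set_eq_iff lengths_iff D.lengths_iff div_closed_simps by metis
qed

text \<open>The submonoid contains \<open>a\<close> and, with \<open>b\<close>, all powers of
  \<open>b\<close>; an element of largest ratio in it therefore meets the condition on powers in
  \<open>ratio_attained\<close>.\<close>

lemma accepted_elasticity_div_closed:
  assumes a: "a \<in> carrier M" and acc: "accepted_elasticity (div_closed_submonoid M a)"
  shows "\<exists>b\<in>carrier M. ratio a \<le> ratio b \<and> (\<forall>j::nat. ratio (b [^] j) \<le> ratio b)"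
proof -
  interpret D: bf_monoid "div_closed_submonoid M a" by (rule div_closed_bf_monoid[OF a])
  interpret S: submonoid "div_closed_gen M a" M by (rule div_closed_gen_submonoid[OF a])
  have r: "D.ratio b = ratio b" if "b \<in> div_closed_gen M a" for b
    using lengths_div_closed[OF a that] by (simp add: D.ratio_def ratio_def div_closed_simps)
  obtain b where b: "b \<in> div_closed_gen M a" "\<And>c. c \<in> div_closed_gen M a \<Longrightarrow> ratio c \<le> ratio b"
    using acc unfolding D.accepted_elasticity_iff div_closed_simps by (metis r)
  have "b [^] j \<in> div_closed_gen M a" for j :: nat
    by (induction j) (use b(1) in auto)
  then show ?thesis using b div_closed_gen_self[OF a] div_closed_gen_subset by blast
qed

text \<open>The elasticity may be infinite or an unattained supremum. Each \<open>q\<close> below it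
  is exceeded by the ratio of some \<open>a\<close>, and so \<open>b\<close> may depend on
  \<open>q\<close>.\<close>

lemma fully_elasticI:
  assumes p: "p \<in> carrier M" "prime M p" "inj_on ((\<otimes>) p) (carrier M)"
    and h: "\<And>a. a \<in> carrier M \<Longrightarrow>
      \<exists>b\<in>carrier M. ratio a \<le> ratio b \<and> (\<forall>j::nat. ratio (b [^] j) \<le> ratio b)"
  shows "fully_elastic M"
  unfolding fully_elastic_def
proof (intro allI impI)
  fix q :: rat assume q: "1 < q \<and> ereal (of_rat q) < elasticity M"
  then obtain a where a: "a \<in> carrier M" "of_rat q < ratio a"
    by (auto simp: elasticity_eq less_SUP_iff)
  obtain b where b: "b \<in> carrier M" "ratio a \<le> ratio b" "\<And>j::nat. ratio (b [^] j) \<le> ratio b"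
    using h[OF a(1)] by blast
  obtain c where "c \<in> carrier M" "ratio c = of_rat q"
    using ratio_attained[OF p b(1,3)] q a(2) b(2) by force
  then show "\<exists>L\<in>system_of_lengths M. rho_set L = ereal (of_rat q)"
    by (auto simp: system_of_lengths_def rho_set_lengths)
qed

lemma fully_elastic_if_accepted:
  assumes p: "p \<in> carrier M" "prime M p" "inj_on ((\<otimes>) p) (carrier M)"
    and acc: "accepted_elasticity M \<or> (\<forall>a\<in>carrier M. accepted_elasticity (div_closed_submonoid M a))"
  shows "fully_elastic M"
proof (rule fully_elasticI[OF p])
  fix a assume a: "a \<in> carrier M"
  show "\<exists>b\<in>carrier M. ratio a \<le> ratio b \<and> (\<forall>j::nat. ratio (b [^] j) \<le> ratio b)"
    using acc
  proof
    assume "accepted_elasticity M"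
    then show ?thesis unfolding accepted_elasticity_iff using a nat_pow_closed by blast
  qed (use a accepted_elasticity_div_closed in blast)
qed

end

lemma (in bf_monoid_cancel) div_closed_bf_monoid_cancel:
  assumes a: "a \<in> carrier M"
  shows "bf_monoid_cancel (div_closed_submonoid M a)"
proof -
  interpret D: bf_monoid "div_closed_submonoid M a" by (rule div_closed_bf_monoid[OF a])
  show ?thesis
    by (unfold_locales, unfold div_closed_simps)
      (use div_closed_gen_subset[of a] l_cancel r_cancel in blast)+
qed

section \<open>Bounded factorizations from a chain condition\<close>

text \<open>The pigeonhole principle as a double count: every entry passes at least one filter. The
  classes will be prime ideals in one application and maximal \<open>r\<close>-ideals in the
  other.\<close>

lemma length_le_sum_filters:
  assumes "finite F" "\<And>t. t \<in> set ts \<Longrightarrow> \<exists>C\<in>F. Q C t"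
  shows "length ts \<le> (\<Sum>C\<in>F. length (filter (Q C) ts))"
  using assms(2)
proof (induction ts)
  case (Cons t ts)
  obtain C where C: "C \<in> F" "Q C t" using Cons.prems by auto
  have "length (t # ts) \<le> (\<Sum>C\<in>F. length (filter (Q C) ts)) + 1" using Cons by simp
  also have "\<dots> \<le> (\<Sum>C\<in>F. length (filter (Q C) ts)) + (\<Sum>C\<in>F. of_bool (Q C t))"
    using member_le_sum[of C F "\<lambda>C. of_bool (Q C t) :: nat"] C assms(1) by simp
  also have "\<dots> = (\<Sum>C\<in>F. length (filter (Q C) (t # ts)))"
    by (subst sum.distrib[symmetric], rule sum.cong) auto
  finally show ?case .
qed simp

section \<open>Ideal quotients and their chain conditions\<close>

locale reduced_comm_monoid_cancel = reduced_comm_monoid + comm_monoid_cancel M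
begin

text \<open>This is the ideal quotient (aM : C). For fixed \<open>a\<close> in the monoid and
  varying \<open>C\<close>, these are the divisorial ideals that contain \<open>a\<close>.\<close>

definition quot :: "'a \<Rightarrow> 'a set \<Rightarrow> 'a set" where
  "quot a C = {x \<in> carrier M. \<forall>c\<in>C. a divides (x \<otimes> c)}"

lemma quot_subset: "quot a C \<subseteq> carrier M"
  by (auto simp: quot_def)

lemma quot_antimono: "C \<subseteq> D \<Longrightarrow> quot a D \<subseteq> quot a C"
  by (auto simp: quot_def)

lemma quot_Un: "quot a C \<inter> quot a D = quot a (C \<union> D)"
  by (auto simp: quot_def)

lemma quot_quot: "C \<subseteq> carrier M \<Longrightarrow> C \<subseteq> quot a (quot a C)"
  by (auto simp: quot_def m_comm subset_iff)

lemma quot_quot_quot: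
  assumes "C \<subseteq> carrier M"
  shows "quot a (quot a (quot a C)) = quot a C"
  using quot_antimono[OF quot_quot[OF assms]] quot_quot[OF quot_subset] by (metis antisym)

lemma divides_mprod_filter:
  "set us \<subseteq> carrier M \<Longrightarrow> mprod (filter Q us) divides mprod us"
proof -
  assume us: "set us \<subseteq> carrier M"
  then have "mprod (filter (\<lambda>x. \<not> Q x) us) \<in> carrier M" by (intro multlist_closed) auto
  then show ?thesis unfolding factor_def using mprod_split[OF us] by blast
qed

lemma divides_mprod_take:
  "set us \<subseteq> carrier M \<Longrightarrow> mprod (take n us) divides mprod us"
proof -
  assume us: "set us \<subseteq> carrier M"
  then have "set (take n us) \<subseteq> carrier M" "set (drop n us) \<subseteq> carrier M"
    using set_take_subset set_drop_subset by fast+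
  then show ?thesis
    using mprod_append[of "take n us" "drop n us"] multlist_closed by (auto simp: factor_def simp del: foldr_append)
qed

text \<open>The Mori condition above \<open>a\<close>, stated as a maximum condition on families
  since the proofs below pick maximal members directly.\<close>

definition quotients_acc :: "'a \<Rightarrow> bool" where
  "quotients_acc a \<longleftrightarrow> (\<forall>\<F>. \<F> \<subseteq> quot a ` Pow (carrier M) \<longrightarrow> \<F> \<noteq> {} \<longrightarrow>
     (\<exists>C\<in>\<F>. \<forall>D\<in>\<F>. C \<subseteq> D \<longrightarrow> C = D))"

context
  fixes a
  assumes a: "a \<in> carrier M" and acc: "quotients_acc a"
begin

lemma quot_maximal:
  assumes "\<F> \<subseteq> quot a ` Pow (carrier M)" "\<F> \<noteq> {}"
  shows "\<exists>C\<in>\<F>. \<forall>D\<in>\<F>. C \<subseteq> D \<longrightarrow> C = D"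
  using acc assms unfolding quotients_acc_def by meson

lemma quot_maximal_seq:
  assumes "range Q \<subseteq> quot a ` Pow (carrier M)"
  shows "\<exists>k. \<forall>l. Q k \<subseteq> Q l \<longrightarrow> Q k = Q l"
  using acc[unfolded quotients_acc_def, rule_format, OF assms] by auto

text \<open>On its own values \<open>quot a\<close> is an order-reversing involution, so the
  ascending condition implies the descending one.\<close>

lemma quot_minimal:
  assumes F: "\<F> \<subseteq> quot a ` Pow (carrier M)" "\<F> \<noteq> {}"
  shows "\<exists>C\<in>\<F>. \<forall>D\<in>\<F>. D \<subseteq> C \<longrightarrow> D = C"
proof -
  have "quot a ` \<F> \<subseteq> quot a ` Pow (carrier M)"
    using F(1) quot_subset by auto
  moreover have "quot a ` \<F> \<noteq> {}" using F(2) by auto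
  ultimately obtain Q where "Q \<in> quot a ` \<F>"
    and Qmax: "\<forall>D\<in>quot a ` \<F>. Q \<subseteq> D \<longrightarrow> Q = D"
    using quot_maximal[of "quot a ` \<F>"] by blast
  then obtain C where C: "C \<in> \<F>" "Q = quot a C" by blast
  have inv: "quot a (quot a D) = D" if D: "D \<in> \<F>" for D
    using F(1) D quot_quot_quot by blast
  show ?thesis
  proof (intro bexI[OF _ C(1)] ballI impI)
    fix D assume D: "D \<in> \<F>" "D \<subseteq> C"
    then have "quot a C = quot a D"
      using Qmax quot_antimono[OF D(2)] C(2) by blast
    then show "D = C" using inv[OF D(1)] inv[OF C(1)] by simp
  qed
qed

text \<open>Write a = u^k b_k. The chain (a : u^k) stops at some k, so b_(k+1), which lies in (a :
  u^(k+1)), also satisfies b_(k+1) u^k = a c for some c. Multiplying by u gives a = a u c, and u is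
  a unit.\<close>

lemma not_all_powers_divide:
  assumes u: "u \<in> carrier M" and dvd: "\<And>k::nat. (u [^] k) divides a"
  shows "u = \<one>"
proof -
  obtain b where b: "\<And>k::nat. b k \<in> carrier M" "\<And>k. a = u [^] k \<otimes> b k"
    using dvd unfolding factor_def by metis
  define Q where "Q k = quot a {u [^] k}" for k :: nat
  have "range Q \<subseteq> quot a ` Pow (carrier M)" using u by (auto simp: Q_def)
  then obtain k where k: "\<And>l. Q k \<subseteq> Q l \<Longrightarrow> Q k = Q l"
    using quot_maximal_seq[of Q] by auto
  have "Q k \<subseteq> Q (Suc k)"
  proof
    fix x assume "x \<in> Q k"
    then have x: "x \<in> carrier M" "a divides (x \<otimes> u [^] k)" by (auto simp: Q_def quot_def)
    then have "a divides ((x \<otimes> u [^] k) \<otimes> u)" using u a by (simp add: divides_prod_r)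
    then show "x \<in> Q (Suc k)" using x u by (simp add: Q_def quot_def m_assoc)
  qed
  then have eq: "Q k = Q (Suc k)" by (rule k)
  have "b (Suc k) \<in> Q (Suc k)"
    using b[of "Suc k"] u m_comm[of "u [^] Suc k" "b (Suc k)"] a
    unfolding Q_def quot_def by (auto simp del: nat_pow_Suc)
  then have "a divides (b (Suc k) \<otimes> u [^] k)" by (simp add: eq[symmetric]) (simp add: Q_def quot_def)
  then obtain c where c: "c \<in> carrier M" "b (Suc k) \<otimes> u [^] k = a \<otimes> c" by (auto simp: factor_def)
  have "u [^] Suc k \<otimes> b (Suc k) = u \<otimes> (b (Suc k) \<otimes> u [^] k)"
    using b(1)[of "Suc k"] u by (simp add: m_ac)
  also have "\<dots> = a \<otimes> (u \<otimes> c)" using c a u by (simp add: m_lcomm)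
  finally have "a \<otimes> \<one> = a \<otimes> (u \<otimes> c)" using b(2)[of "Suc k"] a by (metis r_one)
  then have "u \<otimes> c = \<one>" using l_cancel[of a "\<one>" "u \<otimes> c"] a u c(1) by simp
  then show ?thesis using reduced[of u c] u c(1) by simp
qed

text \<open>Suppose \<open>a\<close> has factorizations into arbitrarily many non-units. Take \<open>J\<close> minimal among the ideals
  \<open>(a : C)\<close> such that \<open>a\<close> is divisible by products of arbitrarily many elements of \<open>T = J - {1}\<close>,
  and let \<open>W\<close> be the union of the ascending chain \<open>(a : T\<^sup>n)\<close>, which is attained at some \<open>n\<close>.
  The maximal ideals of the form \<open>(W : c)\<close> with \<open>c \<notin> W\<close> are prime, finite in number, and together contain
  every factor of \<open>a\<close> from \<open>T\<close>. By the pigeonhole principle one of them could replace \<open>J\<close>, so by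
  minimality it contains \<open>T\<close>. But \<open>cT \<subseteq> W\<close> implies \<open>c \<in> W\<close>.\<close>

lemma factorizations_bounded:
  "\<exists>n. \<forall>us. set us \<subseteq> carrier M - {\<one>} \<longrightarrow> mprod us = a \<longrightarrow> length us \<le> n"
proof (rule ccontr)
  assume "\<not> ?thesis"
  then have long: "\<exists>us. set us \<subseteq> carrier M - {\<one>} \<and> mprod us = a \<and> n < length us" for n
    by (metis not_le)
  \<comment> \<open>Asking the products to divide \<open>a\<close>, rather than to equal it, keeps
    the property available for sublists.\<close>
  define unb where "unb T \<longleftrightarrow> (\<forall>n. \<exists>ts. set ts \<subseteq> T \<and> length ts = n \<and> mprod ts divides a)" for T
  define \<Q> where "\<Q> = quot a ` Pow (carrier M)"
  have \<Q>_Int: "C \<inter> D \<in> \<Q>" if "C \<in> \<Q>" "D \<in> \<Q>" for C D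
    using that quot_Un unfolding \<Q>_def by (auto intro!: imageI)
  have "carrier M = quot a {a}" using a by (auto simp: quot_def factor_def m_comm)
  then have carrier_\<Q>: "carrier M \<in> \<Q>" using a unfolding \<Q>_def by blast
  have "unb (carrier M - {\<one>})"
    unfolding unb_def
  proof
    fix n
    obtain us where us: "set us \<subseteq> carrier M - {\<one>}" "mprod us = a" "n < length us" using long by blast
    then have "set (take n us) \<subseteq> carrier M - {\<one>}" "mprod (take n us) divides a"
      using divides_mprod_take[of us n] set_take_subset[of n us] by blast+
    then show "\<exists>ts. set ts \<subseteq> carrier M - {\<one>} \<and> length ts = n \<and> mprod ts divides a"
      using us(3) by (intro exI[of _ "take n us"]) auto
  qed
  then have ne: "{J \<in> \<Q>. unb (J - {\<one>})} \<noteq> {}" using carrier_\<Q> by blast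
  have "{J \<in> \<Q>. unb (J - {\<one>})} \<subseteq> quot a ` Pow (carrier M)" unfolding \<Q>_def by blast
  from quot_minimal[OF this ne]
  obtain J where J: "J \<in> \<Q>" "unb (J - {\<one>})"
    and Jmin: "\<And>J'. J' \<in> \<Q> \<Longrightarrow> unb (J' - {\<one>}) \<Longrightarrow> J' \<subseteq> J \<Longrightarrow> J' = J"
    by blast
  define T where "T = J - {\<one>}"
  have T: "T \<subseteq> carrier M" using J(1) quot_subset unfolding T_def \<Q>_def by blast
  have Tmp: "mprod ts \<in> carrier M" if "set ts \<subseteq> T" for ts using that T by auto
  define W' where "W' n = {w \<in> carrier M. \<forall>ts. set ts \<subseteq> T \<and> length ts = n \<longrightarrow> a divides (w \<otimes> mprod ts)}" for n
  have W'_quot: "W' n = quot a (mprod ` {ts. set ts \<subseteq> T \<and> length ts = n})" for n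
    by (auto simp: W'_def quot_def)
  have "range W' \<subseteq> quot a ` Pow (carrier M)" using Tmp by (auto simp: W'_quot)
  then obtain N where N: "\<And>n. W' N \<subseteq> W' n \<Longrightarrow> W' N = W' n"
    using quot_maximal_seq[of W'] by auto
  have W'_mono: "W' n \<subseteq> W' (Suc n)" for n
  proof
    fix w assume w: "w \<in> W' n"
    have "a divides (w \<otimes> mprod ts)" if ts: "set ts \<subseteq> T" "length ts = Suc n" for ts
    proof -
      obtain t us where us: "ts = t # us" using ts(2) by (cases ts) auto
      have c: "t \<in> carrier M" "mprod us \<in> carrier M" "w \<in> carrier M" using ts T us w by (auto simp: W'_def)
      have "a divides (w \<otimes> mprod us)" using w ts us by (auto simp: W'_def)
      then have "a divides ((w \<otimes> mprod us) \<otimes> t)" using c a by (simp add: divides_prod_r)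
      then show ?thesis using c us by (simp add: m_ac)
    qed
    then show "w \<in> W' (Suc n)" using w by (auto simp: W'_def)
  qed
  define W where "W = W' N"
  have W_Suc: "W' (Suc N) = W" using N[OF W'_mono] by (simp add: W_def)
  have Wc: "W \<subseteq> carrier M" by (auto simp: W_def W'_def)
  have W_ideal: "w \<otimes> x \<in> W" if "w \<in> W" "x \<in> carrier M" for w x
    unfolding W_def W'_def
  proof (clarify, intro conjI allI impI)
    show "w \<otimes> x \<in> carrier M" using that Wc by auto
    fix ts assume ts: "set ts \<subseteq> T \<and> length ts = N"
    have "a divides (w \<otimes> mprod ts)" using that ts by (auto simp: W_def W'_def)
    then have "a divides ((w \<otimes> mprod ts) \<otimes> x)" using that a Wc Tmp ts by (auto intro!: divides_prod_r)
    moreover have "(w \<otimes> mprod ts) \<otimes> x = w \<otimes> x \<otimes> mprod ts"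
      using that Wc Tmp[of ts] ts by (auto simp: m_ac subset_iff)
    ultimately show "a divides (w \<otimes> x \<otimes> mprod ts)" by simp
  qed
  define P where "P c = {x \<in> carrier M. x \<otimes> c \<in> W}" for c
  have P_\<Q>: "P c \<in> \<Q>" if c: "c \<in> carrier M" for c
  proof -
    have "P c = quot a ((\<lambda>ts. c \<otimes> mprod ts) ` {ts. set ts \<subseteq> T \<and> length ts = N})"
      using c Tmp by (auto simp: P_def W_def W'_def quot_def m_assoc)
    then show ?thesis using c Tmp unfolding \<Q>_def by (intro image_eqI) auto
  qed
  \<comment> \<open>If \<open>c\<close> times every element of \<open>T\<close> lies in
    \<open>W' N\<close>, then \<open>c\<close> lies in \<open>W' (Suc N)\<close>, and this is
    \<open>W\<close> because the chain has stopped at \<open>N\<close>.\<close>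
  have not_T: "c \<in> W" if c: "c \<in> carrier M" "T \<subseteq> P c" for c
  proof -
    have "a divides (c \<otimes> mprod ts)" if ts: "set ts \<subseteq> T" "length ts = Suc N" for ts
    proof -
      obtain t us where us: "ts = t # us" using ts(2) by (cases ts) auto
      have "t \<otimes> c \<in> W" using c(2) ts us by (auto simp: P_def)
      then have "a divides (t \<otimes> c \<otimes> mprod us)" using ts us by (auto simp: W_def W'_def)
      then show ?thesis using us c(1) Tmp[of us] ts T by (simp add: m_ac subset_iff)
    qed
    then show ?thesis using c(1) by (simp add: W_Suc[symmetric] W'_def)
  qed
  \<comment> \<open>If v were in W, then u v would divide v times every product of N elements of T,
    so u would divide all these products. Then u^k divides every product of N k elements; some such
    product divides a, and u = 1 by \<open>not_all_powers_divide\<close>.\<close>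
  have cofactor: "v \<notin> W" if u: "u \<in> T" and v: "v \<in> carrier M" and uv: "a = u \<otimes> v" for u v
  proof
    assume "v \<in> W"
    have uc: "u \<in> carrier M" using u T by blast
    have dvd1: "u divides mprod ts" if ts: "set ts \<subseteq> T" "length ts = N" for ts
    proof -
      have "(u \<otimes> v) divides (v \<otimes> mprod ts)" using \<open>v \<in> W\<close> ts uv by (auto simp: W_def W'_def)
      then have "(v \<otimes> u) divides (v \<otimes> mprod ts)" using m_comm uc v by simp
      then show ?thesis using divides_mult_l uc v Tmp[OF ts(1)] by blast
    qed
    have dvd: "(u [^] k) divides mprod ts" if "set ts \<subseteq> T" "length ts = N * k" for k ts
      using that
    proof (induction k arbitrary: ts)
      case 0
      then show ?case by (auto simp: factor_def)
    next
      case (Suc k)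
      have s: "set (take N ts) \<subseteq> T" "set (drop N ts) \<subseteq> T"
        using Suc.prems(1) set_take_subset[of N ts] set_drop_subset[of N ts] by blast+
      have d: "u divides mprod (take N ts)" "(u [^] k) divides mprod (drop N ts)"
        using dvd1[OF s(1)] Suc.IH[OF s(2)] Suc.prems(2) by simp_all
      obtain x y where xy: "x \<in> carrier M" "mprod (take N ts) = u \<otimes> x"
        "y \<in> carrier M" "mprod (drop N ts) = u [^] k \<otimes> y" using d by (auto simp: factor_def)
      have "mprod ts = mprod (take N ts) \<otimes> mprod (drop N ts)"
        using mprod_append[of "take N ts" "drop N ts"] s T by (auto simp del: foldr_append)
      also have "\<dots> = u [^] Suc k \<otimes> (x \<otimes> y)"
        using xy uc by (simp add: m_ac)
      finally show ?case using xy by (auto simp: factor_def simp del: nat_pow_Suc)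
    qed
    have "(u [^] k) divides a" for k :: nat
    proof -
      obtain ts where ts: "set ts \<subseteq> T" "length ts = N * k" "mprod ts divides a"
        using J(2) unfolding unb_def T_def by blast
      then show ?thesis using dvd[OF ts(1,2)] divides_trans uc by blast
    qed
    then have "u = \<one>" using not_all_powers_divide uc by blast
    then show False using u by (simp add: T_def)
  qed
  define \<M> where "\<M> = {C \<in> P ` (carrier M - W). \<forall>D\<in>P ` (carrier M - W). C \<subseteq> D \<longrightarrow> C = D}"
  have \<M>_\<Q>: "C \<in> \<Q>" if "C \<in> \<M>" for C using that P_\<Q> by (auto simp: \<M>_def)
  have \<M>_max: "C = P d" if "C \<in> \<M>" "d \<in> carrier M" "d \<notin> W" "C \<subseteq> P d" for C d
    using that unfolding \<M>_def by simp
  have \<M>_above: "\<exists>C\<in>\<M>. P c \<subseteq> C" if c: "c \<in> carrier M" "c \<notin> W" for c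
  proof -
    let ?F = "{D \<in> P ` (carrier M - W). P c \<subseteq> D}"
    have "?F \<subseteq> quot a ` Pow (carrier M)" "?F \<noteq> {}" using P_\<Q> c unfolding \<Q>_def by auto
    from quot_maximal[OF this]
    obtain C where C: "C \<in> ?F" "\<forall>D\<in>?F. C \<subseteq> D \<longrightarrow> C = D" by blast
    have "C = D" if "D \<in> P ` (carrier M - W)" "C \<subseteq> D" for D
    proof -
      have "D \<in> ?F" using that C(1) by blast
      then show ?thesis using C(2) that(2) by blast
    qed
    then have "C \<in> \<M>" using C(1) unfolding \<M>_def by simp
    then show ?thesis using C(1) by blast
  qed
  \<comment> \<open>For \<open>y \<notin> P c\<close> the quotient \<open>P (y \<otimes> c)\<close>
    is still one of the proper ones and contains \<open>P c\<close>. By maximality they agree, and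
    \<open>x\<close> lies in \<open>P (y \<otimes> c)\<close>.\<close>
  have \<M>_prime: "x \<in> C" if C: "C \<in> \<M>" and xy: "x \<in> carrier M" "y \<in> carrier M" "x \<otimes> y \<in> C" "y \<notin> C" for C x y
  proof -
    obtain c where c: "c \<in> carrier M" "c \<notin> W" "C = P c" using C by (auto simp: \<M>_def)
    have "y \<otimes> c \<notin> W" using xy c by (auto simp: P_def)
    moreover have "P c \<subseteq> P (y \<otimes> c)"
    proof
      fix z assume z: "z \<in> P c"
      then have "(z \<otimes> c) \<otimes> y \<in> W" using W_ideal xy by (auto simp: P_def)
      then show "z \<in> P (y \<otimes> c)" using z c xy by (auto simp: P_def m_ac)
    qed
    ultimately have "C = P (y \<otimes> c)"
      using xy(2) c by (intro \<M>_max[OF C]) auto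
    moreover have "x \<in> P (y \<otimes> c)" using xy c(1,3) by (simp add: P_def m_assoc)
    ultimately show ?thesis by simp
  qed
  have \<M>_ideal: "x \<otimes> y \<in> C" if C: "C \<in> \<M>" and xy: "x \<in> C" "y \<in> carrier M" for C x y
  proof -
    obtain c where c: "c \<in> carrier M" "C = P c" using C by (auto simp: \<M>_def)
    then have "(x \<otimes> c) \<otimes> y \<in> W" using W_ideal xy by (auto simp: P_def)
    then show ?thesis using c xy by (auto simp: P_def m_ac)
  qed
  have \<M>_subset: "C \<subseteq> carrier M" if "C \<in> \<M>" for C
    using that by (auto simp: \<M>_def P_def)
  \<comment> \<open>For infinitely many distinct members, the descending finite intersections would
    stop at some \<open>I n\<close>, which then lies in \<open>g (Suc n)\<close>. A prime ideal
    containing a finite intersection of ideals contains one of them, so some \<open>g i\<close> with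
    \<open>i \<le> n\<close> equals \<open>g (Suc n)\<close> by maximality.\<close>
  have fin: "finite \<M>"
  proof (rule ccontr)
    assume "infinite \<M>"
    then obtain g :: "nat \<Rightarrow> 'a set" where g: "inj g" "range g \<subseteq> \<M>"
      using infinite_countable_subset by blast
    have gM: "g i \<in> \<M>" for i using g(2) by blast
    define I where "I n = (\<Inter>i\<le>n. g i)" for n :: nat
    have I_Suc: "I (Suc n) = I n \<inter> g (Suc n)" for n by (auto simp: I_def le_Suc_eq)
    have "I n \<in> \<Q>" for n
    proof (induction n)
      case 0
      then show ?case using \<M>_\<Q>[OF gM] by (simp add: I_def)
    next
      case (Suc n)
      then show ?case unfolding I_Suc using \<Q>_Int \<M>_\<Q>[OF gM] by blast
    qed
    then have "range I \<subseteq> quot a ` Pow (carrier M)" unfolding \<Q>_def by blast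
    then obtain n where n: "\<And>m. I m \<subseteq> I n \<Longrightarrow> I m = I n"
      using quot_minimal[of "range I"] by auto
    have "I (Suc n) = I n" by (rule n) (simp add: I_Suc)
    then have sub: "I n \<subseteq> g (Suc n)" using I_Suc by blast
    have "\<exists>x\<in>I m. x \<in> carrier M \<and> x \<notin> C" if "C \<in> \<M>" "\<forall>i\<le>m. \<not> g i \<subseteq> C" for C m
      using that(2)
    proof (induction m)
      case 0
      then show ?case using \<M>_subset[OF gM] by (auto simp: I_def)
    next
      case (Suc m)
      then obtain x where x: "x \<in> I m" "x \<in> carrier M" "x \<notin> C" by auto
      obtain y where y: "y \<in> g (Suc m)" "y \<notin> C" "y \<in> carrier M"
        using Suc.prems \<M>_subset[OF gM] by blast
      have "x \<otimes> y \<notin> C" using \<M>_prime[OF that(1)] x y by blast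
      moreover have "x \<otimes> y \<in> g i" if "i \<le> m" for i
        using \<M>_ideal[OF gM] x y that by (auto simp: I_def)
      moreover have "x \<otimes> y \<in> g (Suc m)"
        using \<M>_ideal[OF gM y(1) x(2)] m_comm x y by simp
      ultimately have "x \<otimes> y \<in> I (Suc m)" "x \<otimes> y \<notin> C" by (auto simp: I_Suc) (auto simp: I_def)
      then show ?case using x(2) y(3) by (intro bexI[of _ "x \<otimes> y"]) auto
    qed
    then obtain i where i: "i \<le> n" "g i \<subseteq> g (Suc n)" using sub gM by blast
    moreover obtain d where "d \<in> carrier M" "d \<notin> W" "g (Suc n) = P d"
      using gM[of "Suc n"] by (auto simp: \<M>_def)
    ultimately have "g i = g (Suc n)" using \<M>_max[OF gM[of i]] by metis
    then show False using g(1) i(1) by (auto dest: injD)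
  qed
  \<comment> \<open>Otherwise each \<open>C\<close> has a number \<open>f C\<close> such that no
    product of \<open>f C\<close> elements of \<open>C \<inter> T\<close> divides \<open>a\<close>.
    A list of one more than the sum of these numbers overfills some \<open>C\<close>, and a
    subproduct contradicts the choice of \<open>f C\<close>.\<close>
  have "\<exists>C\<in>\<M>. unb (C \<inter> J - {\<one>})"
  proof (rule ccontr)
    assume "\<not> ?thesis"
    then have "\<forall>C\<in>\<M>. \<exists>n. \<forall>ts. set ts \<subseteq> C \<inter> T \<longrightarrow> length ts = n \<longrightarrow> \<not> mprod ts divides a"
      unfolding unb_def T_def by (metis Int_Diff)
    then obtain f where f: "\<And>C ts. C \<in> \<M> \<Longrightarrow> set ts \<subseteq> C \<inter> T \<Longrightarrow> length ts = f C \<Longrightarrow> \<not> mprod ts divides a"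
      by metis
    obtain ts where ts: "set ts \<subseteq> T" "length ts = Suc (\<Sum>C\<in>\<M>. f C)" "mprod ts divides a"
      using J(2) unfolding unb_def T_def by blast
    have tc: "set ts \<subseteq> carrier M" using ts(1) T by blast
    \<comment> \<open>The cofactor \<open>v\<close> of \<open>t\<close> in \<open>a\<close> is not
      in \<open>W\<close>, while \<open>t \<otimes> v = a\<close> is. So \<open>t\<close> lies in
      \<open>P v\<close>, which is contained in a maximal quotient.\<close>
    have "\<exists>C\<in>\<M>. t \<in> C" if t: "t \<in> set ts" for t
    proof -
      have tc': "t \<in> carrier M" using t tc by blast
      have r: "mprod (remove1 t ts) \<in> carrier M"
        using tc set_remove1_subset[of t ts] by (intro multlist_closed) auto
      obtain d where d: "d \<in> carrier M" "a = mprod ts \<otimes> d" using ts(3) by (auto simp: factor_def)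
      define v where "v = mprod (remove1 t ts) \<otimes> d"
      have v: "v \<in> carrier M" "a = t \<otimes> v"
        using d r mprod_remove1[OF tc t] tc' by (auto simp: v_def m_assoc)
      have "v \<notin> W" by (rule cofactor[OF _ v]) (use t ts(1) in blast)
      moreover have "t \<in> P v"
      proof -
        have "a \<in> W" unfolding W_def W'_def
          using a Tmp by (auto intro: divides_prod_r)
        then show ?thesis using v tc' by (simp add: P_def)
      qed
      ultimately show ?thesis using \<M>_above v(1) by blast
    qed
    then have "length ts \<le> (\<Sum>C\<in>\<M>. length (filter (\<lambda>t. t \<in> C) ts))"
      by (intro length_le_sum_filters fin)
    also have "\<dots> \<le> (\<Sum>C\<in>\<M>. f C)"
    proof (intro sum_mono)
      fix C assume C: "C \<in> \<M>"
      let ?fs = "filter (\<lambda>t. t \<in> C) ts"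
      show "length ?fs \<le> f C"
      proof (rule ccontr)
        assume "\<not> ?thesis"
        then have len: "length (take (f C) ?fs) = f C" by simp
        have fc: "set ?fs \<subseteq> carrier M" using tc by auto
        have st: "set (take (f C) ?fs) \<subseteq> C \<inter> T"
          using set_take_subset[of "f C" ?fs] ts(1) by auto
        have "mprod (take (f C) ?fs) divides mprod ?fs" by (rule divides_mprod_take[OF fc])
        also have "mprod ?fs divides mprod ts" by (rule divides_mprod_filter[OF tc])
        also note ts(3)
        finally have "mprod (take (f C) ?fs) divides a"
          using st Tmp by blast
        then show False using f[OF C st len] by blast
      qed
    qed
    finally show False using ts(2) by simp
  qed
  then obtain C where C: "C \<in> \<M>" "unb (C \<inter> J - {\<one>})" by blast
  have "C \<inter> J = J" using Jmin[of "C \<inter> J"] C \<Q>_Int[OF \<M>_\<Q> J(1)] by blast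
  moreover obtain c where c: "c \<in> carrier M" "c \<notin> W" "C = P c" using C(1) by (auto simp: \<M>_def)
  ultimately have "T \<subseteq> P c" unfolding T_def by blast
  then show False using not_T c by blast
qed

end

end

section \<open>Monoids of ideals\<close>

locale r_ideal_system =
  fixes G (structure) and H :: "'a set" and r :: "'a set \<Rightarrow> 'a set"
  assumes sys: "ideal_system G H r"
begin

sublocale comm_group G
  using sys by (simp add: ideal_system_def quotient_group_of_def)

lemma H_subset: "H \<subseteq> carrier G" and one_H: "\<one> \<in> H"
  and mult_H: "a \<in> H \<Longrightarrow> b \<in> H \<Longrightarrow> a \<otimes> b \<in> H"
proof -
  have "quotient_group_of G H" using sys by (simp add: ideal_system_def)
  then show "H \<subseteq> carrier G" and "\<one> \<in> H" and "a \<in> H \<Longrightarrow> b \<in> H \<Longrightarrow> a \<otimes> b \<in> H"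
    unfolding quotient_group_of_def by blast+
qed

lemma H_carrier [simp]: "a \<in> H \<Longrightarrow> a \<in> carrier G"
  using H_subset by blast

lemma r_subset: "A \<subseteq> H \<Longrightarrow> r A \<subseteq> H"
  and r_extensive: "A \<subseteq> H \<Longrightarrow> A \<subseteq> r A"
  and r_least: "A \<subseteq> H \<Longrightarrow> B \<subseteq> H \<Longrightarrow> A \<subseteq> r B \<Longrightarrow> r A \<subseteq> r B"
  and coset_subset_r: "a \<in> H \<Longrightarrow> a <# H \<subseteq> r {a}"
  and coset_r: "a \<in> H \<Longrightarrow> A \<subseteq> H \<Longrightarrow> a <# r A = r (a <# A)"
  using sys by (simp_all add: ideal_system_def)

lemma r_mono: "A \<subseteq> B \<Longrightarrow> B \<subseteq> H \<Longrightarrow> r A \<subseteq> r B"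
  using r_least[of A B] r_extensive[of B] by blast

lemma r_idem: "A \<subseteq> H \<Longrightarrow> r (r A) = r A"
  using r_least[of "r A" A] r_extensive[of "r A"] r_subset by blast

lemma set_mult_H: "A \<subseteq> H \<Longrightarrow> B \<subseteq> H \<Longrightarrow> A <#> B \<subseteq> H"
  using mult_H by (auto simp: set_mult_def)

lemma set_mult_comm: "A \<subseteq> carrier G \<Longrightarrow> B \<subseteq> carrier G \<Longrightarrow> A <#> B = B <#> A"
  unfolding set_mult_def using m_comm by (auto simp: subset_iff) metis+

lemma coset_set_mult: "a \<in> carrier G \<Longrightarrow> A \<subseteq> carrier G \<Longrightarrow> B \<subseteq> carrier G \<Longrightarrow>
    a <# (A <#> B) = (a <# A) <#> B"
  by (simp add: l_coset_eq_set_mult set_mult_assoc)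

lemma coset_set_mult_right: "a \<in> carrier G \<Longrightarrow> A \<subseteq> carrier G \<Longrightarrow> B \<subseteq> carrier G \<Longrightarrow>
    a <# (A <#> B) = A <#> (a <# B)"
  using coset_set_mult[of a B A] set_mult_comm[of A B] set_mult_comm[of "a <# B" A]
    l_coset_subset_G[of B a] by simp

lemma coset_coset: "a \<in> carrier G \<Longrightarrow> b \<in> carrier G \<Longrightarrow> A \<subseteq> carrier G \<Longrightarrow> a <# (b <# A) = (a \<otimes> b) <# A"
  by (rule lcos_m_assoc)

lemma coset_inv: "a \<in> carrier G \<Longrightarrow> A \<subseteq> carrier G \<Longrightarrow> inv a <# (a <# A) = A"
  "a \<in> carrier G \<Longrightarrow> A \<subseteq> carrier G \<Longrightarrow> a <# (inv a <# A) = A"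
  by (simp_all add: coset_coset lcos_mult_one)

lemma coset_inject: "a \<in> carrier G \<Longrightarrow> A \<subseteq> carrier G \<Longrightarrow> B \<subseteq> carrier G \<Longrightarrow> a <# A = a <# B \<Longrightarrow> A = B"
  using coset_inv(1) by metis

lemma set_mult_r_subset:
  assumes "A \<subseteq> H" "B \<subseteq> H"
  shows "A <#> r B \<subseteq> r (A <#> B)"
proof
  fix x assume "x \<in> A <#> r B"
  then obtain a b where ab: "a \<in> A" "b \<in> r B" "x = a \<otimes> b" by (auto simp: set_mult_def)
  have "x \<in> a <# r B" using ab by (auto simp: l_coset_def)
  also have "\<dots> = r (a <# B)" using coset_r ab assms by blast
  also have "\<dots> \<subseteq> r (A <#> B)"
    using ab assms by (intro r_mono set_mult_H) (auto simp: set_mult_def l_coset_def)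
  finally show "x \<in> r (A <#> B)" .
qed

text \<open>The closure may be dropped inside a product; associativity of
  \<open>r\<close>-multiplication rests on this.\<close>

lemma r_set_mult_r:
  assumes "A \<subseteq> H" "B \<subseteq> H"
  shows "r (A <#> r B) = r (A <#> B)" "r (r A <#> B) = r (A <#> B)"
proof -
  have *: "r (A <#> r B) = r (A <#> B)" if "A \<subseteq> H" "B \<subseteq> H" for A B
  proof
    show "r (A <#> r B) \<subseteq> r (A <#> B)"
      using that by (intro r_least set_mult_H r_subset set_mult_r_subset)
    show "r (A <#> B) \<subseteq> r (A <#> r B)"
      using that by (intro r_mono set_mult_H r_subset mono_set_mult r_extensive order_refl)
  qed
  show "r (A <#> r B) = r (A <#> B)" using * assms by blast
  have "r A <#> B = B <#> r A" "A <#> B = B <#> A"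
    using assms r_subset[of A] H_subset by (intro set_mult_comm; blast)+
  then show "r (r A <#> B) = r (A <#> B)" using *[of B A] assms by simp
qed

lemma r_singleton: "a \<in> H \<Longrightarrow> r {a} = a <# H"
proof -
  have one: "\<one> <# H = H" using lcos_mult_one[OF H_subset] .
  have r1: "r {\<one>} = H"
    using coset_subset_r[OF one_H] r_subset[of "{\<one>}"] one one_H by auto
  assume "a \<in> H"
  then show ?thesis
    using coset_r[of a "{\<one>}"] one_H r1 by (simp add: l_coset_def)
qed

lemma r_idealsD:
  assumes "I \<in> r_ideals H r"
  shows "I \<subseteq> H" "r I = I" "I \<noteq> {}" "I \<subseteq> carrier G"
  using assms H_subset by (auto simp: r_ideals_def r_ideal_def)

lemma r_idealsI: "A \<subseteq> H \<Longrightarrow> A \<noteq> {} \<Longrightarrow> r A \<in> r_ideals H r"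
  using r_subset r_idem r_extensive[of A] by (auto simp: r_ideals_def r_ideal_def)

lemma ideal_absorb: "I \<in> r_ideals H r \<Longrightarrow> x \<in> I \<Longrightarrow> h \<in> H \<Longrightarrow> x \<otimes> h \<in> I"
proof -
  assume I: "I \<in> r_ideals H r" and x: "x \<in> I" and h: "h \<in> H"
  have "x \<otimes> h \<in> r {x}" using coset_subset_r[of x] r_idealsD[OF I] x h by (auto simp: l_coset_def)
  also have "\<dots> \<subseteq> r I" using r_idealsD[OF I] x by (intro r_mono) auto
  finally show ?thesis using r_idealsD[OF I] by simp
qed

lemma ideal_mult_subset:
  assumes "I \<in> r_ideals H r" "A \<subseteq> H"
  shows "r (I <#> A) \<subseteq> I" "r (A <#> I) \<subseteq> I"
proof -
  have "I <#> A \<subseteq> I" using ideal_absorb assms by (auto simp: set_mult_def)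
  then show *: "r (I <#> A) \<subseteq> I" using r_mono[of "I <#> A" I] r_idealsD[OF assms(1)] by simp
  have "A <#> I = I <#> A" using r_idealsD[OF assms(1)] assms H_subset by (intro set_mult_comm) auto
  then show "r (A <#> I) \<subseteq> I" using * by simp
qed

lemma r_H: "r H = H"
  using r_subset[of H] r_extensive[of H] by blast

lemma H_in_r_ideals: "H \<in> r_ideals H r"
  using r_H one_H by (auto simp: r_ideals_def r_ideal_def)

lemma set_mult_nonempty: "A \<noteq> {} \<Longrightarrow> B \<noteq> {} \<Longrightarrow> A <#> B \<noteq> {}"
  by (auto simp: set_mult_def)

lemma H_mult_ideal: "I \<in> r_ideals H r \<Longrightarrow> H <#> I = I"
proof
  assume I: "I \<in> r_ideals H r"
  have "H <#> I = I <#> H" using r_idealsD[OF I] H_subset by (intro set_mult_comm) auto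
  then show "H <#> I \<subseteq> I" using ideal_absorb[OF I] by (auto simp: set_mult_def)
  show "I \<subseteq> H <#> I" using one_H r_idealsD(4)[OF I] by (force simp: set_mult_def)
qed

lemma Ir_simps:
  "carrier (Ir_monoid G H r) = r_ideals H r"
  "I \<otimes>\<^bsub>Ir_monoid G H r\<^esub> J = r (I <#> J)"
  "\<one>\<^bsub>Ir_monoid G H r\<^esub> = H"
  by (simp_all add: Ir_monoid_def)

lemma Ir_closed: "I \<in> r_ideals H r \<Longrightarrow> J \<in> r_ideals H r \<Longrightarrow> r (I <#> J) \<in> r_ideals H r"
  by (intro r_idealsI set_mult_H set_mult_nonempty) (auto dest: r_idealsD)

sublocale Ir: reduced_comm_monoid "Ir_monoid G H r"
proof (unfold_locales, unfold Ir_simps)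
  fix I J K assume I: "I \<in> r_ideals H r" and J: "J \<in> r_ideals H r"
  show "r (I <#> J) \<in> r_ideals H r" using I J by (rule Ir_closed)
  show "r (I <#> J) = r (J <#> I)" using set_mult_comm r_idealsD(4) I J by simp
  show "I = H" if "r (I <#> J) = H"
    using ideal_mult_subset(1)[OF I r_idealsD(1)[OF J]] that r_idealsD(1)[OF I] by blast
  assume K: "K \<in> r_ideals H r"
  note s = I[THEN r_idealsD(1)] J[THEN r_idealsD(1)] K[THEN r_idealsD(1)]
  show "r (r (I <#> J) <#> K) = r (I <#> r (J <#> K))"
    using s I J K by (simp add: r_set_mult_r set_mult_H set_mult_assoc r_idealsD(4))
next
  fix I assume I: "I \<in> r_ideals H r"
  show "r (H <#> I) = I" using I r_idealsD(2) by (simp add: H_mult_ideal)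
  moreover have "I <#> H = H <#> I" using r_idealsD[OF I] H_subset by (intro set_mult_comm) auto
  ultimately show "r (I <#> H) = I" by simp
qed (rule H_in_r_ideals)

section \<open>Principal and invertible ideals\<close>

lemma principal_ideal: "a \<in> H \<Longrightarrow> a <# H \<in> r_ideals H r"
  using r_idealsI[of "{a}"] by (simp add: r_singleton)

lemma principal_mult:
  assumes a: "a \<in> H" and I: "I \<in> r_ideals H r"
  shows "r ((a <# H) <#> I) = a <# I"
proof -
  have "(a <# H) <#> I = a <# (H <#> I)"
    using a H_subset r_idealsD(4)[OF I] by (intro coset_set_mult[symmetric]) auto
  then show ?thesis using coset_r[OF a r_idealsD(1)[OF I]] r_idealsD(2)[OF I] by (simp add: H_mult_ideal[OF I])
qed

text \<open>The value of \<open>frac_r\<close> does not depend on the denominator picked by the choice operator.\<close>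

lemma frac_r_eq:
  assumes S: "S \<subseteq> carrier G" and c: "c \<in> H" "c <# S \<subseteq> H"
  shows "frac_r G H r S = inv c <# r (c <# S)"
proof -
  define d where "d = (SOME c. c \<in> H \<and> c <# S \<subseteq> H)"
  have d: "d \<in> H" "d <# S \<subseteq> H"
    using someI[of "\<lambda>c. c \<in> H \<and> c <# S \<subseteq> H" c] c by (auto simp: d_def)
  have rc: "r (c <# S) \<subseteq> carrier G" "r (d <# S) \<subseteq> carrier G"
    using r_subset[OF c(2)] r_subset[OF d(2)] H_subset by auto
  have "c <# r (d <# S) = d <# r (c <# S)"
    using c d S by (simp add: coset_r coset_coset m_comm)
  then have "inv c <# (c <# r (d <# S)) = inv c <# (d <# r (c <# S))" by simp
  moreover have "inv c <# (d <# r (c <# S)) = d <# (inv c <# r (c <# S))"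
    using c d rc by (simp add: coset_coset m_comm)
  ultimately have "r (d <# S) = d <# (inv c <# r (c <# S))"
    using c d rc by (simp add: coset_inv)
  then have "inv d <# r (d <# S) = inv c <# r (c <# S)"
    using c d rc by (simp add: coset_inv l_coset_subset_G)
  then show ?thesis by (simp add: frac_r_def d_def)
qed

text \<open>Clearing the denominator of the fractional inverse turns invertibility into dividing a
  principal ideal, so that all later arguments stay inside \<open>H\<close>.\<close>

lemma r_invertible_iff:
  assumes I: "I \<in> r_ideals H r"
  shows "r_invertible G H r I \<longleftrightarrow> (\<exists>K\<in>r_ideals H r. \<exists>c\<in>H. r (I <#> K) = c <# H)"
proof
  assume "r_invertible G H r I"
  then obtain J where J: "J \<subseteq> carrier G" "frac_r G H r (I <#> J) = H" "\<exists>c\<in>H. c <# J \<subseteq> H"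
    by (auto simp: r_invertible_def frac_r_ideal_def fractional_def)
  then obtain c where c: "c \<in> H" "c <# J \<subseteq> H" by auto
  note IH = r_idealsD(1)[OF I] and IG = r_idealsD(4)[OF I]
  have eq: "c <# (I <#> J) = I <#> (c <# J)"
    using c J(1) IG by (simp add: coset_set_mult_right)
  have sub: "I <#> (c <# J) \<subseteq> H" using IH c(2) by (rule set_mult_H)
  have IJ: "I <#> J \<subseteq> carrier G" using IG J(1) by (rule set_mult_closed)
  have "inv c <# r (I <#> (c <# J)) = H"
    using frac_r_eq[OF IJ c(1)] eq sub J(2) by simp
  then have "c <# H = r (I <#> (c <# J))"
    using coset_inv(2)[of c "r (I <#> (c <# J))"] r_subset[OF sub] H_subset c(1) by auto
  then have K: "r (I <#> r (c <# J)) = c <# H"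
    using r_set_mult_r(1)[OF IH c(2)] by simp
  \<comment> \<open>The empty set may be an \<open>r\<close>-ideal, so it has to be excluded as an
    inverse: its product with \<open>I\<close> would be empty, but \<open>c <# H\<close> is
    not.\<close>
  have "r (c <# J) \<noteq> {}"
  proof
    assume e: "r (c <# J) = {}"
    then have "c <# J = {}" using r_extensive[OF c(2)] by auto
    then have "r {} = {}" using e by simp
    then show False using K e one_H by (auto simp: set_mult_def l_coset_def)
  qed
  then have "r (c <# J) \<in> r_ideals H r"
    using r_subset[OF c(2)] r_idem[OF c(2)] by (simp add: r_ideals_def r_ideal_def)
  then show "\<exists>K\<in>r_ideals H r. \<exists>c\<in>H. r (I <#> K) = c <# H" using K c(1) by blast
next
  assume "\<exists>K\<in>r_ideals H r. \<exists>c\<in>H. r (I <#> K) = c <# H"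
  then obtain K c where K: "K \<in> r_ideals H r" and c: "c \<in> H" and eq: "r (I <#> K) = c <# H" by auto
  let ?J = "inv c <# K"
  have J: "?J \<subseteq> carrier G" "c <# ?J = K"
    using r_idealsD(4)[OF K] c by (auto simp: coset_inv l_coset_subset_G)
  have "frac_r G H r ?J = ?J"
    using frac_r_eq[OF J(1) c] J(2) r_idealsD[OF K] by simp
  moreover have "fractional G H ?J"
    using J c r_idealsD(1)[OF K] by (auto simp: fractional_def)
  moreover have "frac_r G H r (I <#> ?J) = H"
  proof -
    have "c <# (I <#> ?J) = I <#> K"
      using c J r_idealsD(4)[OF I] by (simp add: coset_set_mult_right)
    then show ?thesis
      using frac_r_eq[of "I <#> ?J" c] c J(1) eq r_idealsD[OF I] r_idealsD[OF K] H_subset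
      by (simp add: set_mult_closed set_mult_H coset_inv)
  qed
  ultimately show "r_invertible G H r I"
    unfolding r_invertible_def frac_r_ideal_def by blast
qed

text \<open>Multiplication by the complementary ideal \<open>K\<close> turns the product of
  \<open>I\<close> and \<open>A\<close> into \<open>c <# A\<close>, and \<open>c\<close> can be
  cancelled in the group.\<close>

lemma invertible_cancel:
  assumes I: "I \<in> r_ideals H r" "r_invertible G H r I"
  shows "inj_on ((\<otimes>\<^bsub>Ir_monoid G H r\<^esub>) I) (carrier (Ir_monoid G H r))"
proof (rule inj_onI)
  obtain K c where K: "K \<in> r_ideals H r" and c: "c \<in> H" and eq: "r (I <#> K) = c <# H"
    using I r_invertible_iff by blast
  have *: "c <# A = K \<otimes>\<^bsub>Ir_monoid G H r\<^esub> (I \<otimes>\<^bsub>Ir_monoid G H r\<^esub> A)" if A: "A \<in> r_ideals H r" for A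
  proof -
    have "c <# A = (I \<otimes>\<^bsub>Ir_monoid G H r\<^esub> K) \<otimes>\<^bsub>Ir_monoid G H r\<^esub> A"
      using principal_mult[OF c A] eq by (simp add: Ir_simps)
    then show ?thesis using Ir.m_comm[of I K] Ir.m_assoc[of K I A] I K A by (simp add: Ir_simps)
  qed
  fix A B assume AB: "A \<in> carrier (Ir_monoid G H r)" "B \<in> carrier (Ir_monoid G H r)"
    "I \<otimes>\<^bsub>Ir_monoid G H r\<^esub> A = I \<otimes>\<^bsub>Ir_monoid G H r\<^esub> B"
  then have "c <# A = c <# B" using *[of A] *[of B] by (simp add: Ir_simps)
  then show "A = B"
    using AB c by (intro coset_inject[of c A B]) (auto simp: Ir_simps dest: r_idealsD)
qed

lemma invertible_factor:
  assumes "I \<in> r_ideals H r" "J \<in> r_ideals H r" "r_invertible G H r (r (I <#> J))"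
  shows "r_invertible G H r J"
proof -
  obtain K c where K: "K \<in> r_ideals H r" "c \<in> H" "r (r (I <#> J) <#> K) = c <# H"
    using assms r_invertible_iff Ir_closed by blast
  have "r (J <#> r (I <#> K)) = c <# H"
    using K Ir.m_assoc[of I J K] Ir.m_lcomm[of I J K] assms by (simp add: Ir_simps)
  then show ?thesis using K assms Ir_closed r_invertible_iff by blast
qed

lemma invertible_mult:
  assumes I: "I \<in> r_ideals H r" "r_invertible G H r I" and J: "J \<in> r_ideals H r" "r_invertible G H r J"
  shows "r_invertible G H r (r (I <#> J))"
proof -
  let ?M = "Ir_monoid G H r"
  obtain K c where K: "K \<in> r_ideals H r" "c \<in> H" "r (I <#> K) = c <# H"
    using I r_invertible_iff by blast
  obtain L d where L: "L \<in> r_ideals H r" "d \<in> H" "r (J <#> L) = d <# H"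
    using J r_invertible_iff by blast
  have cs: "I \<in> carrier ?M" "J \<in> carrier ?M" "K \<in> carrier ?M" "L \<in> carrier ?M"
    using I J K L by (simp_all add: Ir_simps)
  have "(I \<otimes>\<^bsub>?M\<^esub> J) \<otimes>\<^bsub>?M\<^esub> (K \<otimes>\<^bsub>?M\<^esub> L) = (I \<otimes>\<^bsub>?M\<^esub> K) \<otimes>\<^bsub>?M\<^esub> (J \<otimes>\<^bsub>?M\<^esub> L)"
    using cs by (simp add: Ir.m_ac)
  also have "\<dots> = c <# (d <# H)"
    using principal_mult[OF K(2) principal_ideal[OF L(2)]] K L by (simp add: Ir_simps)
  also have "\<dots> = (c \<otimes> d) <# H" using K L H_subset by (simp add: coset_coset)
  finally show ?thesis
    using K L I J r_invertible_iff[OF Ir_closed[OF I(1) J(1)]] Ir_closed mult_H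
    unfolding Ir_simps by blast
qed

lemma H_invertible: "r_invertible G H r H"
  using r_invertible_iff[OF H_in_r_ideals] H_in_r_ideals one_H H_mult_ideal[OF H_in_r_ideals] r_H
    lcos_mult_one[OF H_subset] by metis

text \<open>The quotient is the closure of Z = c^(-1) J K, where the closure of I K is c H. It is
  integral since J K \<subseteq> I K \<subseteq> c H, and c I Z has the same closure as (I K) J,
  namely c J.\<close>

lemma invertible_quotient:
  assumes I: "I \<in> r_ideals H r" "r_invertible G H r I" and J: "J \<in> r_ideals H r" "J \<subseteq> I"
  shows "\<exists>W\<in>r_ideals H r. r (I <#> W) = J"
proof -
  let ?M = "Ir_monoid G H r"
  obtain K c where K: "K \<in> r_ideals H r" and c: "c \<in> H" and eq: "r (I <#> K) = c <# H"
    using I r_invertible_iff by blast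
  note D = r_idealsD[OF I(1)] r_idealsD[OF J(1)] r_idealsD[OF K]
  have IK: "I <#> K \<subseteq> H" "J <#> K \<subseteq> H" using D(1,5,9) set_mult_H by simp_all
  have "J <#> K \<subseteq> I <#> K" using J(2) by (intro mono_set_mult) auto
  then have sub: "J <#> K \<subseteq> c <# H" using r_extensive[OF IK(1)] eq by auto
  define Z where "Z = inv c <# (J <#> K)"
  have cZ: "c <# Z = J <#> K" unfolding Z_def using c IK(2) H_subset by (intro coset_inv(2)) auto
  have "Z \<subseteq> inv c <# (c <# H)" unfolding Z_def using sub by (auto simp: l_coset_def)
  then have ZH: "Z \<subseteq> H" using c H_subset by (simp add: coset_inv)
  have "J <#> K \<noteq> {}" using D set_mult_nonempty by blast
  then have Zne: "Z \<noteq> {}" by (auto simp: Z_def l_coset_def)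
  have W: "r Z \<in> r_ideals H r" using ZH Zne by (rule r_idealsI)
  have "c <# r (I <#> r Z) = c <# r (I <#> Z)" using r_set_mult_r(1)[OF D(1) ZH] by simp
  also have "\<dots> = r (c <# (I <#> Z))" using c D(1) ZH set_mult_H by (intro coset_r) auto
  also have "c <# (I <#> Z) = I <#> (J <#> K)"
    using c D(4) ZH H_subset by (subst coset_set_mult_right) (auto simp: cZ)
  also have "r (I <#> (J <#> K)) = I \<otimes>\<^bsub>?M\<^esub> (J \<otimes>\<^bsub>?M\<^esub> K)"
    using r_set_mult_r(1)[OF D(1) IK(2)] by (simp add: Ir_simps)
  also have "\<dots> = (I \<otimes>\<^bsub>?M\<^esub> K) \<otimes>\<^bsub>?M\<^esub> J"
    using I(1) J(1) K Ir.m_comm[of J K] Ir.m_assoc[of I K J] unfolding Ir_simps(1) by metis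
  also have "\<dots> = c <# J" using principal_mult[OF c J(1)] eq by (simp add: Ir_simps)
  finally have "c <# r (I <#> r Z) = c <# J" .
  then have "r (I <#> r Z) = J"
    by (rule coset_inject[OF H_carrier[OF c] r_idealsD(4)[OF Ir_closed[OF I(1) W]] D(8)])
  then show ?thesis using W by blast
qed

lemma Ir_star_eq:
  "Ir_star_monoid G H r = Ir_monoid G H r\<lparr>carrier := {I \<in> r_ideals H r. r_invertible G H r I}\<rparr>"
  by (simp add: Ir_star_monoid_def Ir_monoid_def)

lemma Ir_star_simps:
  "carrier (Ir_star_monoid G H r) = {I \<in> r_ideals H r. r_invertible G H r I}"
  "I \<otimes>\<^bsub>Ir_star_monoid G H r\<^esub> J = r (I <#> J)"
  "\<one>\<^bsub>Ir_star_monoid G H r\<^esub> = H"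
  by (simp_all add: Ir_star_monoid_def)

lemma Ir_star_submonoid: "submonoid {I \<in> r_ideals H r. r_invertible G H r I} (Ir_monoid G H r)"
  by (unfold_locales, unfold Ir_simps)
    (auto intro: Ir_closed invertible_mult H_in_r_ideals H_invertible)

sublocale Ir_star: reduced_comm_monoid_cancel "Ir_star_monoid G H r"
proof -
  interpret comm_monoid "Ir_star_monoid G H r"
    unfolding Ir_star_eq by (rule Ir.submonoid_is_comm_monoid[OF Ir_star_submonoid])
  have l: "A = B" if "r (I <#> A) = r (I <#> B)" "I \<in> r_ideals H r" "r_invertible G H r I"
      "A \<in> r_ideals H r" "B \<in> r_ideals H r" for I A B
    using inj_onD[OF invertible_cancel[OF that(2,3)]] that by (simp add: Ir_simps)
  have c: "r (A <#> I) = r (I <#> A)" if "I \<in> r_ideals H r" "A \<in> r_ideals H r" for I A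
    using that r_idealsD(4) set_mult_comm by metis
  show "reduced_comm_monoid_cancel (Ir_star_monoid G H r)"
  proof (unfold_locales, unfold Ir_star_simps)
    show "I = H" if "I \<in> {I \<in> r_ideals H r. r_invertible G H r I}"
      "J \<in> {I \<in> r_ideals H r. r_invertible G H r I}" "r (I <#> J) = H" for I J
      using Ir.reduced[of I J] that by (simp add: Ir_simps)
    show "A = B" if "r (I <#> A) = r (I <#> B)" "A \<in> {I \<in> r_ideals H r. r_invertible G H r I}"
      "B \<in> {I \<in> r_ideals H r. r_invertible G H r I}" "I \<in> {I \<in> r_ideals H r. r_invertible G H r I}" for I A B
      using l[of I A B] that by simp
    show "A = B" if "r (A <#> I) = r (B <#> I)" "A \<in> {I \<in> r_ideals H r. r_invertible G H r I}"
      "B \<in> {I \<in> r_ideals H r. r_invertible G H r I}" "I \<in> {I \<in> r_ideals H r. r_invertible G H r I}" for I A B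
      using l[of I A B] c[of I A] c[of I B] that by simp
  qed
qed

lemma Ir_divides_iff:
  assumes I: "I \<in> r_ideals H r" "r_invertible G H r I" and J: "J \<in> r_ideals H r"
  shows "I divides\<^bsub>Ir_monoid G H r\<^esub> J \<longleftrightarrow> J \<subseteq> I"
  unfolding factor_def Ir_simps
  using invertible_quotient[OF I J] ideal_mult_subset(1)[OF I(1)] r_idealsD(1) by metis

text \<open>Here the quotient must itself be invertible; it is, being a factor of the invertible
  ideal \<open>J\<close>.\<close>

lemma Ir_star_divides_iff:
  assumes I: "I \<in> r_ideals H r" "r_invertible G H r I" and J: "J \<in> r_ideals H r" "r_invertible G H r J"
  shows "I divides\<^bsub>Ir_star_monoid G H r\<^esub> J \<longleftrightarrow> J \<subseteq> I"
proof
  assume "I divides\<^bsub>Ir_star_monoid G H r\<^esub> J"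
  then show "J \<subseteq> I"
    unfolding factor_def Ir_star_simps using ideal_mult_subset(1)[OF I(1)] r_idealsD(1) by blast
next
  assume "J \<subseteq> I"
  then obtain W where "W \<in> r_ideals H r" "r (I <#> W) = J" using invertible_quotient I J by blast
  then show "I divides\<^bsub>Ir_star_monoid G H r\<^esub> J"
    unfolding factor_def Ir_star_simps using invertible_factor[OF I(1)] J(2) by blast
qed

lemma prime_ideal_prime:
  assumes P: "prime_r_ideal G H r P" "P \<in> r_ideals H r" "r_invertible G H r P"
  shows "prime (Ir_monoid G H r) P"
  unfolding prime_def
proof (intro conjI ballI impI)
  show "P \<notin> Units (Ir_monoid G H r)"
    using P(1) by (simp add: Ir.Units_reduced Ir_simps prime_r_ideal_def)
next
  fix A B assume A: "A \<in> carrier (Ir_monoid G H r)" and B: "B \<in> carrier (Ir_monoid G H r)"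
    and dvd: "P divides\<^bsub>Ir_monoid G H r\<^esub> (A \<otimes>\<^bsub>Ir_monoid G H r\<^esub> B)"
  have AB: "A \<in> r_ideals H r" "B \<in> r_ideals H r" using A B by (simp_all add: Ir_simps)
  have H: "A \<subseteq> H" "B \<subseteq> H" using AB r_idealsD(1) by auto
  have "r (A <#> B) \<subseteq> P" using dvd Ir_divides_iff[OF P(2,3) Ir_closed[OF AB]] by (simp add: Ir_simps)
  then have "A <#> B \<subseteq> P" using r_extensive[OF set_mult_H[OF H]] by blast
  then have "a \<otimes> b \<in> P" if "a \<in> A" "b \<in> B" for a b using that by (auto simp: set_mult_def)
  then have "a \<in> P \<or> b \<in> P" if "a \<in> A" "b \<in> B" for a b
    using P(1) that H unfolding prime_r_ideal_def by blast
  then have "A \<subseteq> P \<or> B \<subseteq> P" by blast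
  then show "P divides\<^bsub>Ir_monoid G H r\<^esub> A \<or> P divides\<^bsub>Ir_monoid G H r\<^esub> B"
    using Ir_divides_iff[OF P(2,3)] AB by simp
qed

end

section \<open>Noetherian ideal systems\<close>

locale r_noetherian_system = r_ideal_system +
  assumes noeth: "r_noetherian H r"
begin

lemma maximal_r_ideal:
  assumes "\<And>I. I \<in> \<R> \<Longrightarrow> r_ideal H r I" "\<R> \<noteq> {}"
  shows "\<exists>I\<in>\<R>. \<forall>J\<in>\<R>. I \<subseteq> J \<longrightarrow> I = J"
proof (rule ccontr)
  assume "\<not> ?thesis"
  then have step: "\<exists>J\<in>\<R>. I \<subset> J" if "I \<in> \<R>" for I using that by blast
  have "\<exists>f. \<forall>n. f n \<in> \<R> \<and> f n \<subset> f (Suc n)"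
    using assms(2) step by (intro dependent_nat_choice) auto
  then obtain f :: "nat \<Rightarrow> 'a set" where f: "\<And>n. f n \<in> \<R>" "\<And>n. f n \<subset> f (Suc n)" by blast
  then have "\<forall>n. r_ideal H r (f n) \<and> f n \<subseteq> f (Suc n)" using assms(1) by blast
  then obtain m where m: "\<forall>n\<ge>m. f n = f m" using noeth unfolding r_noetherian_def by blast
  have "f (Suc m) = f m" by (rule m[rule_format]) simp
  then show False using f(2)[of m] by simp
qed

text \<open>The ideal quotient \<open>(A : C)\<close> in the monoid of invertible ideals is determined by the ideal of all
  \<open>h\<close> with \<open>h K \<subseteq> A\<close> for every \<open>K \<in> C\<close>.\<close>

lemma Ir_star_quotients_acc:
  assumes A: "A \<in> carrier (Ir_star_monoid G H r)"
  shows "Ir_star.quotients_acc A"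
  unfolding Ir_star.quotients_acc_def
proof (intro allI impI)
  let ?S = "{I \<in> r_ideals H r. r_invertible G H r I}"
  fix \<F> assume F: "\<F> \<subseteq> Ir_star.quot A ` Pow (carrier (Ir_star_monoid G H r))" "\<F> \<noteq> {}"
  \<comment> \<open>Testing with principal ideals makes \<open>\<phi>\<close> depend on
    \<open>\<J>\<close> only, whereas a set \<open>C\<close> with quotient \<open>\<J>\<close> is
    not unique. The fact \<open>phi\<close> below supplies the description in terms of
    \<open>C\<close>.\<close>
  define \<phi> where "\<phi> \<J> = {h \<in> H. h <# H \<in> \<J>}" for \<J>
  have A': "A \<in> r_ideals H r" "r_invertible G H r A" using A by (auto simp: Ir_star_simps)
  have prin: "h <# H \<in> ?S" if "h \<in> H" for h
  proof -
    have "r ((h <# H) <#> H) = h <# H" using principal_mult[OF that H_in_r_ideals] .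
    then show ?thesis
      using r_invertible_iff[OF principal_ideal[OF that]] H_in_r_ideals principal_ideal that by blast
  qed
  have key: "r_ideal H r (\<phi> \<J>) \<and> \<J> = {I \<in> ?S. I \<subseteq> \<phi> \<J>}" if "\<J> \<in> \<F>" for \<J>
  proof -
    obtain C where C: "C \<subseteq> ?S" "\<J> = Ir_star.quot A C" using F(1) \<open>\<J> \<in> \<F>\<close> by (auto simp: Ir_star_simps)
    have mem: "I \<in> \<J> \<longleftrightarrow> (\<forall>K\<in>C. \<forall>x\<in>I. \<forall>k\<in>K. x \<otimes> k \<in> A)" if I: "I \<in> ?S" for I
    proof -
      have "A divides\<^bsub>Ir_star_monoid G H r\<^esub> (I \<otimes>\<^bsub>Ir_star_monoid G H r\<^esub> K)
              \<longleftrightarrow> (\<forall>x\<in>I. \<forall>k\<in>K. x \<otimes> k \<in> A)" if K: "K \<in> C" for K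
      proof -
        have K': "K \<in> r_ideals H r" "r_invertible G H r K" using K C by auto
        have IK: "I <#> K \<subseteq> H" using I K'(1) by (intro set_mult_H r_idealsD(1)) auto
        have "A divides\<^bsub>Ir_star_monoid G H r\<^esub> (I \<otimes>\<^bsub>Ir_star_monoid G H r\<^esub> K) \<longleftrightarrow> r (I <#> K) \<subseteq> A"
          unfolding Ir_star_simps using I K' A'
          by (intro Ir_star_divides_iff Ir_closed invertible_mult) auto
        also have "\<dots> \<longleftrightarrow> I <#> K \<subseteq> A"
          using r_extensive[OF IK] r_mono[of "I <#> K" A] r_idealsD[OF A'(1)] by auto
        also have "\<dots> \<longleftrightarrow> (\<forall>x\<in>I. \<forall>k\<in>K. x \<otimes> k \<in> A)" by (auto simp: set_mult_def)
        finally show ?thesis .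
      qed
      then show ?thesis using I by (auto simp: C(2) Ir_star.quot_def Ir_star_simps(1))
    qed
    have phi: "\<phi> \<J> = {h \<in> H. \<forall>K\<in>C. \<forall>k\<in>K. h \<otimes> k \<in> A}"
    proof -
      have "h <# H \<in> \<J> \<longleftrightarrow> (\<forall>K\<in>C. \<forall>k\<in>K. h \<otimes> k \<in> A)" if h: "h \<in> H" for h
      proof -
        have "(\<forall>x\<in>h <# H. \<forall>k\<in>K. x \<otimes> k \<in> A) \<longleftrightarrow> (\<forall>k\<in>K. h \<otimes> k \<in> A)" if K: "K \<in> C" for K
        proof
          assume l: "\<forall>x\<in>h <# H. \<forall>k\<in>K. x \<otimes> k \<in> A"
          have "h \<in> h <# H" using one_H h by (force simp: l_coset_def)
          then show "\<forall>k\<in>K. h \<otimes> k \<in> A" using l by blast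
        next
          assume r: "\<forall>k\<in>K. h \<otimes> k \<in> A"
          have KH: "K \<subseteq> H" using K C r_idealsD(1) by auto
          have "(h \<otimes> y) \<otimes> k \<in> A" if "y \<in> H" "k \<in> K" for y k
          proof -
            have "k \<in> H" using that KH by blast
            then have "(h \<otimes> y) \<otimes> k = (h \<otimes> k) \<otimes> y" using h that by (simp add: m_ac)
            then show ?thesis using ideal_absorb[OF A'(1)] r that by simp
          qed
          then show "\<forall>x\<in>h <# H. \<forall>k\<in>K. x \<otimes> k \<in> A" by (auto simp: l_coset_def)
        qed
        then show ?thesis using mem[OF prin[OF h]] by simp
      qed
      then show ?thesis by (auto simp: \<phi>_def)
    qed
    have sub: "\<phi> \<J> \<subseteq> H" by (auto simp: \<phi>_def)
    \<comment> \<open>Multiplication by an element \<open>k\<close> of some \<open>K \<in> C\<close>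
      commutes with \<open>r\<close>, so k r(\<open>\<phi> \<J>\<close>) is the closure of a subset
      of the closed set \<open>A\<close>.\<close>
    have "r (\<phi> \<J>) \<subseteq> \<phi> \<J>"
    proof
      fix h assume h: "h \<in> r (\<phi> \<J>)"
      then have hH: "h \<in> H" using r_subset[OF sub] by blast
      have "h \<otimes> k \<in> A" if "K \<in> C" "k \<in> K" for K k
      proof -
        have k: "k \<in> H" using that C r_idealsD(1)[of K] by auto
        have comm: "k \<otimes> x = x \<otimes> k" if "x \<in> H" for x using that k m_comm by simp
        have "k <# \<phi> \<J> \<subseteq> A" using that by (auto simp: phi l_coset_def comm)
        then have "r (k <# \<phi> \<J>) \<subseteq> A" using r_mono[of _ A] r_idealsD[OF A'(1)] by metis
        then have "k \<otimes> h \<in> A" using h coset_r[OF k sub] by (auto simp: l_coset_def)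
        then show ?thesis using m_comm hH k by simp
      qed
      then show "h \<in> \<phi> \<J>" using hH by (simp add: phi)
    qed
    then have "r_ideal H r (\<phi> \<J>)" using sub r_extensive[OF sub] by (auto simp: r_ideal_def)
    moreover have "\<J> = {I \<in> ?S. I \<subseteq> \<phi> \<J>}"
    proof (rule Set.set_eqI)
      fix I
      have "\<J> \<subseteq> ?S" by (auto simp: C(2) Ir_star.quot_def Ir_star_simps)
      moreover have "I \<in> \<J> \<longleftrightarrow> I \<subseteq> \<phi> \<J>" if I: "I \<in> ?S"
      proof -
        have "I \<subseteq> H" using I r_idealsD(1)[of I] by auto
        then show ?thesis unfolding mem[OF I] phi by blast
      qed
      ultimately show "I \<in> \<J> \<longleftrightarrow> I \<in> {I \<in> ?S. I \<subseteq> \<phi> \<J>}" by blast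
    qed
    ultimately show ?thesis by blast
  qed
  have "\<exists>I\<in>\<phi> ` \<F>. \<forall>J\<in>\<phi> ` \<F>. I \<subseteq> J \<longrightarrow> I = J"
    using key F(2) by (intro maximal_r_ideal) auto
  then obtain \<J> where J: "\<J> \<in> \<F>" "\<And>\<J>'. \<J>' \<in> \<F> \<Longrightarrow> \<phi> \<J> \<subseteq> \<phi> \<J>' \<Longrightarrow> \<phi> \<J> = \<phi> \<J>'" by auto
  show "\<exists>C\<in>\<F>. \<forall>D\<in>\<F>. C \<subseteq> D \<longrightarrow> C = D"
  proof (intro bexI[OF _ J(1)] ballI impI)
    fix D assume D: "D \<in> \<F>" "\<J> \<subseteq> D"
    then have "\<phi> \<J> = \<phi> D" by (intro J(2)) (auto simp: \<phi>_def)
    then show "\<J> = D" using key[OF J(1)] key[OF D(1)] by metis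
  qed
qed

sublocale Ir_star: bf_monoid_cancel "Ir_star_monoid G H r"
  by unfold_locales (rule Ir_star.factorizations_bounded[OF _ Ir_star_quotients_acc])

lemma proper_in_maximal:
  assumes "I \<in> r_ideals H r" "I \<noteq> H"
  shows "\<exists>M. max_r_ideal H r M \<and> I \<subseteq> M"
proof -
  define \<R> where "\<R> = {J. r_ideal H r J \<and> I \<subseteq> J \<and> J \<noteq> H}"
  have "I \<in> \<R>" using assms by (simp add: \<R>_def r_ideals_def)
  then obtain M where M: "M \<in> \<R>" "\<forall>J\<in>\<R>. M \<subseteq> J \<longrightarrow> M = J"
    using maximal_r_ideal[of \<R>] by (auto simp: \<R>_def)
  have "J = M" if "r_ideal H r J \<and> M \<subseteq> J \<and> J \<noteq> H" for J
  proof -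
    have "J \<in> \<R>" using that M(1) by (auto simp: \<R>_def)
    then show ?thesis using M(2) that by blast
  qed
  then have "max_r_ideal H r M"
    unfolding max_r_ideal_def using M(1) by (simp add: \<R>_def)
  then show ?thesis using M(1) by (auto simp: \<R>_def)
qed

section \<open>Products of arbitrary \<open>r\<close>-ideals and powers of maximal ones\<close>

lemma set_pow_H: "A \<subseteq> H \<Longrightarrow> set_pow G A n \<subseteq> H"
  by (induction n) (use one_H set_mult_H in auto)

lemma r_set_pow_antimono:
  assumes A: "A \<subseteq> H" and "A \<noteq> {}" and "m \<le> n"
  shows "r (set_pow G A n) \<subseteq> r (set_pow G A m)"
  using assms(3)
proof (induction rule: dec_induct)
  case (step n)
  have "set_pow G A n \<noteq> {}" for n
    by (induction n) (use assms(2) set_mult_nonempty in auto)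
  then have "r (set_pow G A n) \<in> r_ideals H r" using r_idealsI set_pow_H[OF A] by blast
  then have "r (A <#> r (set_pow G A n)) \<subseteq> r (set_pow G A n)" using A by (rule ideal_mult_subset(2))
  then show ?case using step.IH r_set_mult_r(1)[OF A set_pow_H[OF A]] by auto
qed simp

text \<open>Each factor inside \<open>M\<close> raises the exponent by one; any other factor only
  makes the product smaller.\<close>

lemma mprod_subset_power:
  assumes "set us \<subseteq> r_ideals H r" "M \<subseteq> H"
  shows "Ir.mprod us \<subseteq> r (set_pow G M (length (filter (\<lambda>J. J \<subseteq> M) us)))"
  using assms(1)
proof (induction us)
  case Nil
  then show ?case using r_singleton[OF one_H] lcos_mult_one[OF H_subset] by (simp add: Ir_simps)
next
  case (Cons J us)
  let ?P = "set_pow G M (length (filter (\<lambda>J. J \<subseteq> M) us))"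
  have J: "J \<in> r_ideals H r" and us: "Ir.mprod us \<in> r_ideals H r"
    using Cons.prems Ir.multlist_closed[of us] by (auto simp: Ir_simps)
  have IH: "Ir.mprod us \<subseteq> r ?P" using Cons by simp
  have P: "?P \<subseteq> H" using set_pow_H assms(2) by blast
  have Cons_eq: "Ir.mprod (J # us) = r (J <#> Ir.mprod us)"
    by (simp only: foldr_Cons o_apply Ir_simps(2))
  show ?case
  proof (cases "J \<subseteq> M")
    case True
    have "J <#> Ir.mprod us \<subseteq> M <#> r ?P" using True IH by (rule mono_set_mult)
    then have "r (J <#> Ir.mprod us) \<subseteq> r (M <#> r ?P)"
      using assms(2) P r_subset set_mult_H by (intro r_mono) auto
    then show ?thesis unfolding Cons_eq using True r_set_mult_r(1)[OF assms(2) P] by simp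
  next
    case False
    have "r (J <#> Ir.mprod us) \<subseteq> Ir.mprod us"
      using us r_idealsD(1)[OF J] by (rule ideal_mult_subset(2))
    then show ?thesis unfolding Cons_eq using False IH by simp
  qed
qed

lemma mprod_subset_factor:
  assumes "set us \<subseteq> r_ideals H r" "J \<in> set us"
  shows "Ir.mprod us \<subseteq> J"
proof -
  have J: "J \<in> r_ideals H r" using assms by blast
  have "set (remove1 J us) \<subseteq> r_ideals H r" using assms(1) set_remove1_subset by fast
  then have "Ir.mprod (remove1 J us) \<in> r_ideals H r"
    using Ir.multlist_closed[of "remove1 J us"] by (simp add: Ir_simps)
  then show ?thesis
    using Ir.mprod_remove1[of us J] assms ideal_mult_subset(1)[OF J] r_idealsD(1)
    by (simp add: Ir_simps)
qed

text \<open>In a long product of proper ideals that contains \<open>a\<close>, many factors lie in the same one of the finitely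
  many maximal ideals \<open>M\<close> above \<open>a\<close>, so that \<open>a\<close> lies in a high power of \<open>M\<close>.\<close>

lemma Ir_bf_monoid:
  assumes fin: "finite_r_character H r" and krull: "r_Krull_intersection G H r"
  shows "bf_monoid (Ir_monoid G H r)"
proof unfold_locales
  fix I assume "I \<in> carrier (Ir_monoid G H r)"
  then have I: "I \<in> r_ideals H r" by (simp add: Ir_simps)
  obtain a where a: "a \<in> I" using r_idealsD(3)[OF I] by blast
  then have aH: "a \<in> H" using r_idealsD(1)[OF I] by blast
  define F where "F = {M. max_r_ideal H r M \<and> a \<in> M}"
  have finF: "finite F" using fin aH by (simp add: finite_r_character_def F_def)
  have FM: "M \<in> r_ideals H r - {H}" if "M \<in> F" for M
    using that unfolding F_def max_r_ideal_def r_ideals_def by blast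
  have "\<exists>n. a \<notin> r (set_pow G M n)" if "M \<in> F" for M
    using krull FM[OF that] unfolding r_Krull_intersection_def by blast
  then obtain f where f: "\<And>M. M \<in> F \<Longrightarrow> a \<notin> r (set_pow G M (f M))" by metis
  show "\<exists>n. \<forall>us. set us \<subseteq> carrier (Ir_monoid G H r) - {\<one>\<^bsub>Ir_monoid G H r\<^esub>} \<longrightarrow>
      Ir.mprod us = I \<longrightarrow> length us \<le> n"
  proof (intro exI[of _ "\<Sum>M\<in>F. f M"] allI impI)
    fix us assume us: "set us \<subseteq> carrier (Ir_monoid G H r) - {\<one>\<^bsub>Ir_monoid G H r\<^esub>}" "Ir.mprod us = I"
    have us': "set us \<subseteq> r_ideals H r" "H \<notin> set us" using us(1) unfolding Ir_simps by auto
    \<comment> \<open>A product lies in each of its factors, so \<open>a \<in> J\<close>, and every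
      maximal \<open>r\<close>-ideal above \<open>J\<close> is one of those counted by
      \<open>F\<close>.\<close>
    have "\<exists>M\<in>F. J \<subseteq> M" if J: "J \<in> set us" for J
    proof -
      have "J \<in> r_ideals H r" "J \<noteq> H" using J us' by auto
      then obtain M where M: "max_r_ideal H r M" "J \<subseteq> M" using proper_in_maximal by blast
      have "a \<in> J" using mprod_subset_factor[OF us'(1) J] us(2) a by blast
      then show ?thesis using M by (auto simp: F_def)
    qed
    then have "length us \<le> (\<Sum>M\<in>F. length (filter (\<lambda>J. J \<subseteq> M) us))"
      by (intro length_le_sum_filters finF)
    also have "\<dots> \<le> (\<Sum>M\<in>F. f M)"
    proof (intro sum_mono)
      fix M assume M: "M \<in> F"
      note MD = r_idealsD[of M]
      have MH: "M \<subseteq> H" "M \<noteq> {}" using MD FM[OF M] by auto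
      \<comment> \<open>Powers of \<open>M\<close> descend, so with more than \<open>f M\<close>
        factors inside \<open>M\<close> the element \<open>a\<close> would lie in the power with
        exponent \<open>f M\<close>, which it misses by Krull's intersection property.\<close>
      have "a \<in> r (set_pow G M (length (filter (\<lambda>J. J \<subseteq> M) us)))"
        using mprod_subset_power[OF us'(1) MH(1)] us(2) a by blast
      then show "length (filter (\<lambda>J. J \<subseteq> M) us) \<le> f M"
        using f[OF M] r_set_pow_antimono[OF MH, of "f M"] by (meson nat_le_linear subsetD)
    qed
    finally show "length us \<le> (\<Sum>M\<in>F. f M)" .
  qed
qed

end

theorem theorem4p1:
  fixes G :: "('a, 'b) monoid_scheme" and H :: "'a set" and r :: "'a set \<Rightarrow> 'a set"
  assumes sys: "ideal_system G H r"
    and noeth: "r_noetherian H r"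
  shows "((\<exists>p\<in>carrier (Ir_star_monoid G H r). prime (Ir_star_monoid G H r) p)
           \<and> (accepted_elasticity (Ir_star_monoid G H r)
               \<or> locally_finitely_generated (Ir_star_monoid G H r))
          \<longrightarrow> fully_elastic (Ir_star_monoid G H r))
       \<and> (finite_r_character H r \<and> r_Krull_intersection G H r
          \<and> (\<exists>P. prime_r_ideal G H r P \<and> P \<in> r_ideals H r \<and> r_invertible G H r P)
          \<and> (accepted_elasticity (Ir_monoid G H r)
             \<or> (\<forall>I\<in>carrier (Ir_monoid G H r).
                   accepted_elasticity (div_closed_submonoid (Ir_monoid G H r) I)))
          \<longrightarrow> fully_elastic (Ir_monoid G H r))"
proof (intro conjI impI; elim conjE)
  interpret r_noetherian_system G H r using sys noeth by unfold_locales
  let ?S = "Ir_star_monoid G H r" and ?M = "Ir_monoid G H r"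
  {
    assume "\<exists>p\<in>carrier ?S. prime ?S p" and acc: "accepted_elasticity ?S \<or> locally_finitely_generated ?S"
    then obtain p where p: "p \<in> carrier ?S" "prime ?S p" by blast
    have "inj_on ((\<otimes>\<^bsub>?S\<^esub>) p) (carrier ?S)"
      using p(1) Ir_star.l_cancel by (auto intro!: inj_onI)
    \<comment> \<open>Local finite generation is thereby reduced to accepted elasticity of all
      divisor-closed submonoids with one generator, and both parts end in the same
      criterion.\<close>
    moreover have "accepted_elasticity (div_closed_submonoid ?S a)"
      if "locally_finitely_generated ?S" "a \<in> carrier ?S" for a
      using that bf_monoid_cancel.accepted_elasticity_if_fin_gen[OF Ir_star.div_closed_bf_monoid_cancel]
      by (simp add: locally_finitely_generated_def)
    ultimately show "fully_elastic ?S"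
      using Ir_star.fully_elastic_if_accepted[OF p] acc by blast
  }
  {
    assume "finite_r_character H r" "r_Krull_intersection G H r"
    then interpret M: bf_monoid ?M by (rule Ir_bf_monoid)
    assume "\<exists>P. prime_r_ideal G H r P \<and> P \<in> r_ideals H r \<and> r_invertible G H r P"
      and acc: "accepted_elasticity ?M \<or> (\<forall>I\<in>carrier ?M. accepted_elasticity (div_closed_submonoid ?M I))"
    then obtain P where P: "prime_r_ideal G H r P" "P \<in> r_ideals H r" "r_invertible G H r P" by blast
    show "fully_elastic ?M"
      by (rule M.fully_elastic_if_accepted[OF _ prime_ideal_prime[OF P] invertible_cancel[OF P(2,3)] acc])
        (simp add: Ir_simps P(2))
  }
qed

end
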